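(* Let $Z,D$ be $n\times n$ matrices of one of the following two kinds: (Capelli's case) $Z$ has entry $z_{ab}$ at position $(a,b)$ and $D$ has entry $\partial_{z_{ab}}$ at position $(a,b)$, for all $1\le a,b\le n$; or (Turnbull's case) $Z$ is symmetric with $z_{ab}$ ($a\le b$) at both positions $(a,b)$ and $(b,a)$, and $D$ is symmetric with $\partial_{z_{ab}}$ at both positions $(a,b)$ and $(b,a)$ for $a<b$ and $2\partial_{z_{aa}}$ at the diagonal positions. Let $I=(i_1,\dots,i_r)$ and $J=(j_1,\dots,j_r)$ be multi-indexes with entries in $\{1,\dots,n\}$, let $Q$ be the $r\times r$ matrix $Q_{ab}=\delta_{i_aj_b}$, and let $T$ be the $2r\times2r$ block-diagonal matrix whose $m$-th diagonal $2\times2$ block is $$\begin{pmatrix} r-m+\tfrac14 & \tfrac{i}{4}\\ \tfrac{i}{4} & r-m-\tfrac14\end{pmatrix},\qquad m=1,\dots,r .$$ Then, in the algebra of polynomial-coefficient differential operators in the variables $x_{ab},y_{ab}$, $${\det}^{\mathrm{col}}\big((ZD^t)^{\mathbb R}_{IJ}+Q^{\mathbb R}T\big)=\sum_{L=(1\le l_1<l_2<\dots<l_{2r}\le 2n)}\det\big(Z^{\mathbb R}_{IL}\big)\,\det\big((D^t)^{\mathbb R}_{LJ}\big).$$ The same identity holds if $i$ is replaced by $-i$ in $T$.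
   Context: Here $x_{ab},y_{ab}$ are independent commuting variables (for all $a,b$ in Capelli's case, for $a\le b$ in Turnbull's case), $z_{ab}=x_{ab}+iy_{ab}$, $\partial_{z_{ab}}=\tfrac12\big(\tfrac{\partial}{\partial x_{ab}}-i\tfrac{\partial}{\partial y_{ab}}\big)$, coefficients are in $\mathbb C$. For a matrix $M$ with entries $c=\mathrm{Re}(c)+i\,\mathrm{Im}(c)$, where real and imaginary parts are taken regarding $x_{ab},y_{ab},\partial/\partial x_{ab},\partial/\partial y_{ab}$ as real, $M^{\mathbb R}$ denotes its real form: each entry $c$ is replaced by the $2\times2$ block $\begin{pmatrix}\mathrm{Re}(c)&\mathrm{Im}(c)\\-\mathrm{Im}(c)&\mathrm{Re}(c)\end{pmatrix}$. $D^t$ is the transpose of $D$. Index conventions: in $M^{\mathbb R}_{IJ}$ the multi-indexes $I,J$ of length $r$ refer to rows and columns of $M$, so $(ZD^t)^{\mathbb R}_{IJ}$ is the real form ($2r\times 2r$) of the $r\times r$ matrix with entries $(ZD^t)_{i_aj_b}$; $Z^{\mathbb R}_{IL}$ is the $2r\times2r$ matrix formed from the rows $2i_1-1,2i_1,\dots,2i_r-1,2i_r$ and the columns $l_1,\dots,l_{2r}$ of $Z^{\mathbb R}$; $(D^t)^{\mathbb R}_{LJ}$ is formed from the rows $l_1,\dots,l_{2r}$ and the columns $2j_1-1,2j_1,\dots,2j_r-1,2j_r$ of $(D^t)^{\mathbb R}$. The column-determinant of an $N\times N$ matrix $M$ over a not necessarily commutative ring is ${\det}^{\mathrm{col}}M=\sum_{\sigma\in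 S_N}\mathrm{sgn}(\sigma)\,M_{\sigma(1)1}M_{\sigma(2)2}\cdots M_{\sigma(N)N}$ (factors ordered by column). *)

theory Defs
  imports
    Complex_Main
    "HOL-Library.Poly_Mapping"
    "HOL-Combinatorics.Permutations"
    "Jordan_Normal_Form.Matrix"
begin

section \<open>Polynomials and partial derivatives\<close>

type_synonym 'v cpoly = "('v \<Rightarrow>\<^sub>0 nat) \<Rightarrow>\<^sub>0 complex"

definition pvar :: "'v \<Rightarrow> 'v cpoly" where
  "pvar v = Poly_Mapping.single (Poly_Mapping.single v 1) 1"

definition pconst :: "complex \<Rightarrow> 'v cpoly" where
  "pconst c = Poly_Mapping.single 0 c"

text \<open>
  In the summand below the subtraction of exponents is truncated, but it only truncates when the
  coefficient vanishes.
\<close>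

definition partial_deriv :: "'v \<Rightarrow> 'v cpoly \<Rightarrow> 'v cpoly" where
  "partial_deriv v p =
     (\<Sum>m\<in>Poly_Mapping.keys p.
        Poly_Mapping.single (m - Poly_Mapping.single v 1)
          (of_nat (Poly_Mapping.lookup m v) * Poly_Mapping.lookup p m))"

definition cnj_poly :: "'v cpoly \<Rightarrow> 'v cpoly" where
  "cnj_poly p = Poly_Mapping.map cnj p"

lemma lookup_cnj_poly [simp]: "Poly_Mapping.lookup (cnj_poly p) m = cnj (Poly_Mapping.lookup p m)"
  unfolding cnj_poly_def by (transfer) (auto simp: when_def)

lemma cnj_poly_cnj_poly [simp]: "cnj_poly (cnj_poly p) = p"
  by (rule poly_mapping_eqI) simp

lemma cnj_poly_add [simp]: "cnj_poly (p + q) = cnj_poly p + cnj_poly q"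
  by (rule poly_mapping_eqI) (simp add: lookup_add)

lemma cnj_poly_zero [simp]: "cnj_poly 0 = 0"
  by (rule poly_mapping_eqI) simp

lemma cnj_poly_single [simp]: "cnj_poly (Poly_Mapping.single m c) = Poly_Mapping.single m (cnj c)"
  by (rule poly_mapping_eqI) (simp add: lookup_single when_def)

lemma cpoly_add_induct [case_names zero single add]:
  fixes p :: "'v cpoly"
  assumes "P 0" "\<And>m c. P (Poly_Mapping.single m c)" "\<And>p q. P p \<Longrightarrow> P q \<Longrightarrow> P (p + q)"
  shows "P p"
proof (induction p rule: update_induct)
  case const
  show ?case using assms(1) by simp
next
  case (update f a b)
  have "Poly_Mapping.update a b f = f + Poly_Mapping.single a b"
    using update(1)
    by (intro poly_mapping_eqI)
      (auto simp: lookup_update lookup_add lookup_single when_def in_keys_iff)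
  then show ?case using assms update by simp
qed

lemma cnj_poly_mult [simp]: "cnj_poly (p * q) = cnj_poly p * cnj_poly q"
proof (induction p rule: cpoly_add_induct)
  case (single m c)
  show ?case
    by (induction q rule: cpoly_add_induct) (simp_all add: mult_single distrib_left)
qed (simp_all add: distrib_right)

lemma partial_deriv_superset:
  assumes "finite A" "Poly_Mapping.keys p \<subseteq> A"
  shows "partial_deriv v p =
    (\<Sum>m\<in>A. Poly_Mapping.single (m - Poly_Mapping.single v 1)
          (of_nat (Poly_Mapping.lookup m v) * Poly_Mapping.lookup p m))"
  unfolding partial_deriv_def using assms
  by (intro sum.mono_neutral_left) (auto simp: in_keys_iff)

lemma partial_deriv_zero [simp]: "partial_deriv v 0 = 0"
  by (simp add: partial_deriv_def)

lemma partial_deriv_single: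
  "partial_deriv v (Poly_Mapping.single m c) =
     Poly_Mapping.single (m - Poly_Mapping.single v 1) (of_nat (Poly_Mapping.lookup m v) * c)"
  by (subst partial_deriv_superset[of "{m}"]) auto

lemma partial_deriv_add: "partial_deriv v (p + q) = partial_deriv v p + partial_deriv v q"
proof -
  let ?A = "Poly_Mapping.keys p \<union> Poly_Mapping.keys q"
  have "Poly_Mapping.keys (p + q) \<subseteq> ?A" by (rule keys_add)
  then show ?thesis
    by (simp add: partial_deriv_superset[of ?A] lookup_add distrib_left single_add sum.distrib)
qed

lemma partial_deriv_cnj_poly: "partial_deriv v (cnj_poly p) = cnj_poly (partial_deriv v p)"
  by (induction p rule: cpoly_add_induct)
    (simp_all add: partial_deriv_single partial_deriv_add)

lemma partial_deriv_mult:
  "partial_deriv v (p * q) = partial_deriv v p * q + p * partial_deriv v q"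
proof (induction p rule: cpoly_add_induct)
  case (single m c)
  show ?case
  proof (induction q rule: cpoly_add_induct)
    case (single k d)
    let ?e = "Poly_Mapping.single v (Suc 0)"
    have l: "k + (m - ?e) = k + m - ?e" if "0 < Poly_Mapping.lookup m v"
      using that
      by (intro poly_mapping_eqI) (auto simp: lookup_add lookup_minus lookup_single when_def)
    have r: "m + (k - ?e) = k + m - ?e" if "0 < Poly_Mapping.lookup k v"
      using that
      by (intro poly_mapping_eqI) (auto simp: lookup_add lookup_minus lookup_single when_def)
    show ?case
      by (cases "Poly_Mapping.lookup m v = 0"; cases "Poly_Mapping.lookup k v = 0")
        (simp_all add: mult_single partial_deriv_single lookup_add l r algebra_simps single_add)
  qed (simp_all add: distrib_left partial_deriv_add)
qed (simp_all add: distrib_right partial_deriv_add)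

lemma partial_deriv_pvar: "partial_deriv v (pvar w) = (if v = w then 1 else 0)"
  by (simp add: pvar_def partial_deriv_single lookup_single when_def)

lemma partial_deriv_pconst: "partial_deriv v (pconst c) = 0"
  by (simp add: pconst_def partial_deriv_single)


section \<open>The algebra of polynomial-coefficient differential operators\<close>

inductive_set diff_ops :: "('v cpoly \<Rightarrow> 'v cpoly) set" where
  mult: "(\<lambda>p. q * p) \<in> diff_ops"
| deriv: "partial_deriv v \<in> diff_ops"
| add: "f \<in> diff_ops \<Longrightarrow> g \<in> diff_ops \<Longrightarrow> (\<lambda>p. f p + g p) \<in> diff_ops"
| comp: "f \<in> diff_ops \<Longrightarrow> g \<in> diff_ops \<Longrightarrow> (\<lambda>p. f (g p)) \<in> diff_ops"

lemma diff_ops_0: "(\<lambda>p. 0) \<in> diff_ops"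
proof -
  have "(\<lambda>p. 0 * p) \<in> diff_ops" by (rule diff_ops.mult)
  then show ?thesis by (simp only: mult_zero_left)
qed

lemma diff_ops_1: "(\<lambda>p. p) \<in> diff_ops"
proof -
  have "(\<lambda>p. 1 * p) \<in> diff_ops" by (rule diff_ops.mult)
  then show ?thesis by (simp only: mult_1_left)
qed

lemma diff_ops_uminus:
  assumes "f \<in> diff_ops"
  shows "(\<lambda>p. - f p) \<in> diff_ops"
proof -
  have "(\<lambda>p. (-1) * f p) \<in> diff_ops" by (rule diff_ops.comp[OF diff_ops.mult assms])
  then show ?thesis by simp
qed

lemma diff_ops_diff: "f \<in> diff_ops \<Longrightarrow> g \<in> diff_ops \<Longrightarrow> (\<lambda>p. f p - g p) \<in> diff_ops"
  using diff_ops.add[OF _ diff_ops_uminus] by auto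

lemma diff_ops_add: "f \<in> diff_ops \<Longrightarrow> f (p + q) = f p + f q"
  by (induction arbitrary: p q rule: diff_ops.induct)
    (simp_all add: distrib_left partial_deriv_add algebra_simps)

typedef 'v diffop = "diff_ops :: ('v cpoly \<Rightarrow> 'v cpoly) set"
  morphisms apply_op Abs_diffop
  by (blast intro: diff_ops.mult)

setup_lifting type_definition_diffop
lifting_forget poly_mapping.lifting

instantiation diffop :: (type) ring_1
begin

lift_definition zero_diffop :: "'a diffop" is "\<lambda>p. 0"
  by (rule diff_ops_0)

lift_definition one_diffop :: "'a diffop" is "\<lambda>p. p"
  by (rule diff_ops_1)

lift_definition plus_diffop :: "'a diffop \<Rightarrow> 'a diffop \<Rightarrow> 'a diffop" is "\<lambda>f g p. f p + g p"
  by (rule diff_ops.add)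

lift_definition uminus_diffop :: "'a diffop \<Rightarrow> 'a diffop" is "\<lambda>f p. - f p"
  by (rule diff_ops_uminus)

lift_definition minus_diffop :: "'a diffop \<Rightarrow> 'a diffop \<Rightarrow> 'a diffop" is "\<lambda>f g p. f p - g p"
  by (rule diff_ops_diff)

lift_definition times_diffop :: "'a diffop \<Rightarrow> 'a diffop \<Rightarrow> 'a diffop" is "\<lambda>f g p. f (g p)"
  by (rule diff_ops.comp)

instance
proof
  show "(0::'a diffop) \<noteq> 1"
    by transfer (metis zero_neq_one)
qed (transfer; simp add: fun_eq_iff algebra_simps diff_ops_add)+

end

lift_definition mult_op :: "'v cpoly \<Rightarrow> 'v diffop" is "\<lambda>q p. q * p"
  by (rule diff_ops.mult)

lift_definition deriv_op :: "'v \<Rightarrow> 'v diffop" is partial_deriv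
  by (rule diff_ops.deriv)

abbreviation const_op :: "complex \<Rightarrow> 'v diffop" where
  "const_op c \<equiv> mult_op (pconst c)"

abbreviation var_op :: "'v \<Rightarrow> 'v diffop" where
  "var_op v \<equiv> mult_op (pvar v)"


section \<open>Real and imaginary parts of a differential operator\<close>

text \<open>
  \<open>cnj_op\<close> is the antilinear ring automorphism fixing all variables and all partial derivatives.
  The operators fixed by it are those with real coefficients, and every operator is uniquely
  \<open>a + \<i> b\<close> with \<open>a\<close>, \<open>b\<close> of this kind (\<open>Re_op_Im_op\<close>, \<open>Re_op_Im_op_unique\<close>).
\<close>

lift_definition cnj_op :: "'v diffop \<Rightarrow> 'v diffop" is "\<lambda>f p. cnj_poly (f (cnj_poly p))"
  subgoal for f
  proof (induction rule: diff_ops.induct)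
    case (mult q)
    show ?case using diff_ops.mult[of "cnj_poly q"] by simp
  next
    case (deriv v)
    show ?case using diff_ops.deriv[of v] by (simp add: partial_deriv_cnj_poly)
  next
    case (add f g)
    then show ?case using diff_ops.add by auto
  next
    case (comp f g)
    then show ?case using diff_ops.comp[OF comp(3,4)] by simp
  qed
  done

definition Re_op :: "'v diffop \<Rightarrow> 'v diffop" where
  "Re_op c = const_op (1 / 2) * (c + cnj_op c)"

definition Im_op :: "'v diffop \<Rightarrow> 'v diffop" where
  "Im_op c = const_op (1 / (2 * \<i>)) * (c - cnj_op c)"

lemma cnj_op_add: "cnj_op (a + b) = cnj_op a + cnj_op b"
  by transfer simp

lemma cnj_op_mult: "cnj_op (a * b) = cnj_op a * cnj_op b"
  by transfer simp

lemma cnj_op_const_op: "cnj_op (const_op c) = const_op (cnj c)"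
  by transfer (simp add: pconst_def)

lemma cnj_op_var_op: "cnj_op (var_op v) = var_op v"
  by transfer (simp add: pvar_def)

lemma cnj_op_deriv_op: "cnj_op (deriv_op v) = deriv_op v"
  by transfer (simp add: partial_deriv_cnj_poly)

lemma cnj_op_cnj_op: "cnj_op (cnj_op a) = a"
  by transfer simp

lemma cnj_op_diff: "cnj_op (a - b) = cnj_op a - cnj_op b"
  by (metis add_diff_cancel_right' cnj_op_add diff_add_cancel)

lemma const_op_mult: "const_op a * const_op b = const_op (a * b)"
  by transfer (simp add: pconst_def mult_single flip: mult.assoc)

lemma const_op_add: "const_op a + const_op b = const_op (a + b)"
  by transfer (simp add: pconst_def single_add flip: distrib_right)

lemma const_op_1: "const_op 1 = 1"
  by transfer (simp add: pconst_def)

lemma const_op_0: "const_op 0 = 0"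
  by transfer (simp add: pconst_def)

lemma cnj_op_Re_op: "cnj_op (Re_op c) = Re_op c"
  by (simp add: Re_op_def cnj_op_mult cnj_op_add cnj_op_const_op cnj_op_cnj_op add.commute)

lemma const_op_neg: "const_op (- c) = - const_op c"
  by (metis const_op_add const_op_0 add_eq_0_iff add.right_inverse)

lemma cnj_op_Im_op: "cnj_op (Im_op c) = Im_op c"
proof -
  have "cnj (1 / (2 * \<i>)) = - (1 / (2 * \<i>))" by simp
  then show ?thesis
    by (simp only: Im_op_def cnj_op_mult cnj_op_diff cnj_op_const_op cnj_op_cnj_op const_op_neg)
      (simp add: right_diff_distrib)
qed

lemma const_op_half: "const_op (1 / 2) * (a + a) = a"
proof -
  have "const_op (1 / 2) * (a + a) = (const_op (1 / 2) + const_op (1 / 2)) * a"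
    by (simp add: distrib_left distrib_right)
  also have "\<dots> = a"
    by (simp only: const_op_add) (simp add: const_op_1)
  finally show ?thesis .
qed

lemma Re_op_Im_op: "c = Re_op c + const_op \<i> * Im_op c"
proof -
  have "const_op \<i> * Im_op c = const_op (1 / 2) * (c - cnj_op c)"
    by (simp add: Im_op_def const_op_mult flip: mult.assoc)
  then have "Re_op c + const_op \<i> * Im_op c = const_op (1 / 2) * (c + c)"
    by (simp add: Re_op_def flip: distrib_left)
  then show ?thesis by (simp only: const_op_half)
qed

lemma Re_op_Im_op_unique:
  assumes "cnj_op a = a" "cnj_op b = b" "c = a + const_op \<i> * b"
  shows "Re_op c = a" "Im_op c = b"
proof -
  have c: "cnj_op c = a - const_op \<i> * b"
    using assms(1,2) unfolding assms(3)
    by (simp add: cnj_op_add cnj_op_mult cnj_op_const_op const_op_neg)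
  have "c + cnj_op c = a + a" "c - cnj_op c = const_op \<i> * (b + b)"
    unfolding c by (simp_all add: assms(3) distrib_left)
  then have "Re_op c = const_op (1 / 2) * (a + a)" "Im_op c = const_op (1 / 2) * (b + b)"
    by (simp_all add: Re_op_def Im_op_def const_op_mult flip: mult.assoc)
  then show "Re_op c = a" "Im_op c = b"
    by (simp_all only: const_op_half)
qed


section \<open>Matrices of differential operators\<close>

text \<open>
  Rows and columns are numbered from \<open>0\<close>, as in the matrix library; so the rows \<open>2i - 1, 2i\<close> of a
  real form, counted from \<open>1\<close>, become \<open>2i, 2i + 1\<close>.
\<close>

definition real_form :: "'v diffop mat \<Rightarrow> 'v diffop mat" where
  "real_form M = mat (2 * dim_row M) (2 * dim_col M) (\<lambda>(p, q).
     let c = M $$ (p div 2, q div 2) in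
     if even p then (if even q then Re_op c else Im_op c)
     else (if even q then - Im_op c else Re_op c))"

definition minor_mat :: "'a mat \<Rightarrow> nat list \<Rightarrow> nat list \<Rightarrow> 'a mat" where
  "minor_mat M I J = mat (length I) (length J) (\<lambda>(a, b). M $$ (I ! a, J ! b))"

definition real_index :: "nat list \<Rightarrow> nat list" where
  "real_index I = concat (map (\<lambda>i. [2 * i, 2 * i + 1]) I)"

text \<open>
  The column-determinant. For a matrix with pairwise commuting entries this is the usual
  determinant, whose library version requires a commutative ring.
\<close>

definition col_det :: "'a::ring_1 mat \<Rightarrow> 'a" where
  "col_det M = (\<Sum>\<sigma> | \<sigma> permutes {0..<dim_row M}.
     of_int (sign \<sigma>) * prod_list (map (\<lambda>k. M $$ (\<sigma> k, k)) [0..<dim_row M]))"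

definition increasing_indices :: "nat \<Rightarrow> nat \<Rightarrow> nat list set" where
  "increasing_indices k N = {L. length L = k \<and> sorted_wrt (<) L \<and> set L \<subseteq> {0..<N}}"


section \<open>The matrices of Capelli's and Turnbull's cases\<close>

text \<open>
  \<open>VX a b\<close> and \<open>VY a b\<close> stand for the variables \<open>x\<^sub>a\<^sub>b\<close> and \<open>y\<^sub>a\<^sub>b\<close>. The type has infinitely many
  variables; for given \<open>n\<close> only those with indices below \<open>n\<close> occur in the matrices below (and only
  those with \<open>a \<le> b\<close> in Turnbull's case).
\<close>

datatype var = VX nat nat | VY nat nat

definition z_op :: "nat \<Rightarrow> nat \<Rightarrow> var diffop" where
  "z_op a b = var_op (VX a b) + const_op \<i> * var_op (VY a b)"

definition dz_op :: "nat \<Rightarrow> nat \<Rightarrow> var diffop" where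
  "dz_op a b = const_op (1 / 2) * (deriv_op (VX a b) - const_op \<i> * deriv_op (VY a b))"

lemma Re_Im_z_op:
  "Re_op (z_op a b) = var_op (VX a b)" "Im_op (z_op a b) = var_op (VY a b)"
  by (rule Re_op_Im_op_unique[OF cnj_op_var_op cnj_op_var_op z_op_def])+

lemma Re_Im_dz_op:
  "Re_op (dz_op a b) = const_op (1 / 2) * deriv_op (VX a b)"
  "Im_op (dz_op a b) = - (const_op (1 / 2) * deriv_op (VY a b))"
proof -
  let ?p = "const_op (1 / 2) * deriv_op (VX a b)" and ?q = "const_op (- 1 / 2) * deriv_op (VY a b)"
  have *: "cnj_op ?p = ?p" "cnj_op ?q = ?q"
    by (simp_all add: cnj_op_mult cnj_op_const_op cnj_op_deriv_op)
  have "dz_op a b = ?p + const_op \<i> * ?q"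
    by (simp add: dz_op_def right_diff_distrib const_op_mult const_op_neg flip: mult.assoc)
  from Re_op_Im_op_unique[OF * this]
  show "Re_op (dz_op a b) = ?p" "Im_op (dz_op a b) = - (const_op (1 / 2) * deriv_op (VY a b))"
    by (simp_all add: const_op_neg)
qed

definition capelli_Z :: "nat \<Rightarrow> var diffop mat" where
  "capelli_Z n = mat n n (\<lambda>(a, b). z_op a b)"

definition capelli_D :: "nat \<Rightarrow> var diffop mat" where
  "capelli_D n = mat n n (\<lambda>(a, b). dz_op a b)"

definition turnbull_Z :: "nat \<Rightarrow> var diffop mat" where
  "turnbull_Z n = mat n n (\<lambda>(a, b). z_op (min a b) (max a b))"

definition turnbull_D :: "nat \<Rightarrow> var diffop mat" where
  "turnbull_D n = mat n n (\<lambda>(a, b). if a = b then 2 * dz_op a a else dz_op (min a b) (max a b))"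

definition Q_mat :: "nat list \<Rightarrow> nat list \<Rightarrow> var diffop mat" where
  "Q_mat I J = mat (length I) (length J) (\<lambda>(a, b). if I ! a = J ! b then 1 else 0)"

text \<open>The parameter \<open>s\<close> is \<open>\<i>\<close> or \<open>- \<i>\<close>; the blocks are numbered by \<open>m = 1, \<dots>, r\<close>.\<close>

definition T_block :: "complex \<Rightarrow> nat \<Rightarrow> nat \<Rightarrow> complex mat" where
  "T_block s r m = mat_of_rows_list 2
     [[of_nat r - of_nat m + 1 / 4, s / 4],
      [s / 4, of_nat r - of_nat m - 1 / 4]]"

definition T_mat :: "complex \<Rightarrow> nat \<Rightarrow> var diffop mat" where
  "T_mat s r = map_mat const_op (diag_block_mat (map (T_block s r) [1..<r + 1]))"

end

theory Submission
  imports Defs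
begin

text \<open>
  Let \<open>\<psi>\<^sub>p\<close> be anticommuting elements of square zero that commute with the entries of a matrix \<open>M\<close>, and
  form the sums \<open>\<Phi>\<^sub>k = \<Sum>\<^sub>p \<psi>\<^sub>p M\<^sub>p\<^sub>k\<close>. Then \<open>\<Phi>\<^sub>0 \<Phi>\<^sub>1 \<cdots>\<close> is the sum of
  \<open>\<psi>\<^sub>L col_det M\<^sub>L\<close> over increasing \<open>L\<close> (\<open>prod_sum_col_det\<close>), and for square \<open>M\<close> it is the top
  monomial times the column-determinant. Both sides of the identity are treated as products of this
  kind. The \<open>\<psi>\<^sub>p\<close> act on Fock space, the functions on sets of indices with values in the algebra
  of differential operators; that algebra acts from the left (\<open>lmult\<close>) and from the right
  (\<open>rmult\<close>). Multiplying derivatives from the right keeps them behind all coordinates,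
  so the right-hand side is the vacuum value of a product \<open>\<Lambda>\<^sub>0 \<Lambda>\<^sub>1 \<cdots>\<close> in which the derivatives
  are multiplied from the right, while in the product \<open>\<Phi>\<^sub>0 \<Phi>\<^sub>1 \<cdots>\<close> for the left-hand side
  everything is multiplied from the left.

  Write \<open>\<psi>\<^sub>2\<^sub>a = (\<theta>\<^sub>a + \<theta>'\<^sub>a) / 2\<close> and \<open>\<psi>\<^sub>2\<^sub>a\<^sub>+\<^sub>1 = (\<theta>\<^sub>a - \<theta>'\<^sub>a) / 2\<i>\<close>. Then the combinations
  \<open>\<Phi>\<^sub>2\<^sub>m \<plusminus> \<i> \<Phi>\<^sub>2\<^sub>m\<^sub>+\<^sub>1\<close> of two columns of a real form involve only the complex matrix and only
  its conjugate, respectively. For the left-hand side with \<open>s = \<i>\<close> they are \<open>A\<^sub>m\<close> and \<open>b\<^sub>m + q\<^sub>m / 2\<close>, where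
  \<open>a\<^sub>m = \<Sum>\<^sub>k \<zeta>\<^sub>k d\<^sub>m\<^sub>k\<close>, \<open>\<zeta>\<^sub>k = \<Sum>\<^sub>a \<theta>\<^sub>a z\<^sub>a\<^sub>k\<close>, \<open>q\<^sub>m = \<Sum>\<^sub>a \<theta>\<^sub>a Q\<^sub>a\<^sub>m\<close>, \<open>A\<^sub>m = a\<^sub>m + (r - m - 1) q\<^sub>m\<close> with
  \<open>m\<close> counted from \<open>0\<close>, and \<open>b\<^sub>m\<close> is the conjugate of \<open>A\<^sub>m\<close>. For the right-hand side they
  are \<open>\<alpha>\<^sub>m\<close> and its conjugate \<open>\<alpha>'\<^sub>m\<close>, where \<open>\<alpha>\<^sub>m\<close> is \<open>a\<^sub>m\<close> with the derivatives multiplied from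
  the right. In both cases the commutation rules of coordinates and derivatives give
  \<open>a\<^sub>m \<alpha>\<^sub>j = - \<alpha>\<^sub>j a\<^sub>m - q\<^sub>m \<alpha>\<^sub>j\<close> and \<open>a\<^sub>m a\<^sub>m = a\<^sub>m q\<^sub>m\<close> (\<open>column_normal_column\<close>,
  \<open>column_sq\<close>); in the symmetric case the additional term of the commutator drops out because a
  symmetric matrix is contracted with \<open>\<theta>\<^sub>a \<theta>\<^sub>b\<close> (\<open>symmetric_contraction\<close>).

  Consequently \<open>A\<^sub>m A\<^sub>m = A\<^sub>m q\<^sub>m\<close>, and this is exactly what the summand \<open>q\<^sub>m / 2\<close> cancels:
  \<open>\<Phi>\<^sub>2\<^sub>m \<Phi>\<^sub>2\<^sub>m\<^sub>+\<^sub>1 = \<i>/2 (A\<^sub>m b\<^sub>m + b\<^sub>m b\<^sub>m / 2)\<close>, compared with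
  \<open>\<Lambda>\<^sub>2\<^sub>m \<Lambda>\<^sub>2\<^sub>m\<^sub>+\<^sub>1 = \<i>/2 \<alpha>\<^sub>m \<alpha>'\<^sub>m\<close>. The terms with \<open>b\<^sub>m b\<^sub>m\<close> carry too many generators \<open>\<theta>'\<close>: the
  top monomial contains each of the \<open>r\<close> generators \<open>\<theta>'\<close> once, while a product of
  \<open>r\<close> pairs with at least one factor \<open>b\<^sub>m b\<^sub>m\<close> has more than \<open>r\<close> of them. In the remaining product the shifts
  \<open>r - m - 1\<close> turn \<open>A\<^sub>m\<close> and \<open>b\<^sub>m\<close> into \<open>\<alpha>\<^sub>m\<close> and \<open>\<alpha>'\<^sub>m\<close>, from the last column to the first,
  by the usual argument for Capelli's identity. This is \<open>corrected_word_eq_normal_word\<close>. The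
  statement for \<open>s = - \<i>\<close> follows by applying \<open>cnj_op\<close>, which fixes the entries of real forms.
\<close>

section \<open>Commuting and anticommuting elements\<close>

definition acomm :: "'a::ring_1 \<Rightarrow> 'a \<Rightarrow> bool" where
  "acomm x y \<longleftrightarrow> x * y = - (y * x)"

definition comm :: "'a::ring_1 \<Rightarrow> 'a \<Rightarrow> bool" where
  "comm x y \<longleftrightarrow> x * y = y * x"

lemma comm_sym: "comm x y \<Longrightarrow> comm y x"
  by (simp add: comm_def)

lemma comm_mult_left: "comm x z \<Longrightarrow> comm y z \<Longrightarrow> comm (x * y) z"
  by (metis comm_def mult.assoc)

lemma comm_mult_right: "comm z x \<Longrightarrow> comm z y \<Longrightarrow> comm z (x * y)"
  by (metis comm_def mult.assoc)

lemma comm_sum_left: "(\<And>k. k \<in> A \<Longrightarrow> comm (f k) z) \<Longrightarrow> comm (sum f A) z"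
  by (simp add: comm_def sum_distrib_left sum_distrib_right)

lemma comm_sum_right: "(\<And>k. k \<in> A \<Longrightarrow> comm z (f k)) \<Longrightarrow> comm z (sum f A)"
  by (simp add: comm_def sum_distrib_left sum_distrib_right)

lemma comm_add_left: "comm x z \<Longrightarrow> comm y z \<Longrightarrow> comm (x + y) z"
  by (simp add: comm_def distrib_left distrib_right)

lemma comm_add_right: "comm z x \<Longrightarrow> comm z y \<Longrightarrow> comm z (x + y)"
  by (simp add: comm_def distrib_left distrib_right)

lemma comm_diff_left: "comm x z \<Longrightarrow> comm y z \<Longrightarrow> comm (x - y) z"
  by (simp add: comm_def left_diff_distrib right_diff_distrib)

lemma comm_diff_right: "comm z x \<Longrightarrow> comm z y \<Longrightarrow> comm z (x - y)"
  by (simp add: comm_def left_diff_distrib right_diff_distrib)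

lemma comm_uminus: "comm x y \<Longrightarrow> comm (- x) y" "comm x y \<Longrightarrow> comm x (- y)"
  by (simp_all add: comm_def)

lemma comm_prod_list: "(\<And>x. x \<in> set xs \<Longrightarrow> comm y x) \<Longrightarrow> comm y (prod_list xs)"
  by (induction xs) (simp_all add: comm_mult_right, simp add: comm_def)

lemma acomm_sym: "acomm x y \<Longrightarrow> acomm y x"
  by (simp add: acomm_def)

lemma acomm_mult_left:
  assumes "acomm x z" "comm c z"
  shows "acomm (x * c) z"
proof -
  have "x * c * z = x * z * c"
    using assms(2) by (simp add: comm_def mult.assoc)
  also have "\<dots> = - (z * (x * c))"
    using assms(1) by (simp add: acomm_def mult.assoc)
  finally show ?thesis
    by (simp add: acomm_def)
qed

lemma acomm_mult_right: "acomm z x \<Longrightarrow> comm z c \<Longrightarrow> acomm z (x * c)"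
  by (intro acomm_sym[OF acomm_mult_left] acomm_sym[of z x] comm_sym[of z c])

lemma acomm_sum_left: "(\<And>k. k \<in> A \<Longrightarrow> acomm (f k) z) \<Longrightarrow> acomm (sum f A) z"
  by (simp add: acomm_def sum_distrib_left sum_distrib_right sum_negf)

lemma acomm_sum_right: "(\<And>k. k \<in> A \<Longrightarrow> acomm z (f k)) \<Longrightarrow> acomm z (sum f A)"
  by (simp add: acomm_def sum_distrib_left sum_distrib_right sum_negf)

lemma acomm_add: "acomm z x \<Longrightarrow> acomm z y \<Longrightarrow> acomm z (x + y)"
  by (simp add: acomm_def distrib_left distrib_right)

lemma acomm_add_left: "acomm x z \<Longrightarrow> acomm y z \<Longrightarrow> acomm (x + y) z"
  by (simp add: acomm_def distrib_left distrib_right)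

lemma acomm_diff_left: "acomm x z \<Longrightarrow> acomm y z \<Longrightarrow> acomm (x - y) z"
  by (simp add: acomm_def left_diff_distrib right_diff_distrib)

lemma acomm_diff_right: "acomm z x \<Longrightarrow> acomm z y \<Longrightarrow> acomm z (x - y)"
  by (simp add: acomm_def left_diff_distrib right_diff_distrib)

lemma mult_of_nat_left: "(x :: 'a::ring_1) * (of_nat k * y) = of_nat k * (x * y)"
  by (induction k) (simp_all add: distrib_left distrib_right)

lemma acomm_of_nat: "acomm z x \<Longrightarrow> acomm z (of_nat k * x)"
  by (simp add: acomm_def mult_of_nat_left mult.assoc)

lemma half_acomm_self:
  fixes x h :: "'a::ring_1"
  assumes "h + h = 1" "acomm x x"
  shows "x * x = 0"
proof -
  have "x * x = (h + h) * (x * x)" by (simp add: assms(1))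
  also have "\<dots> = h * (x * x + x * x)" by (simp add: distrib_left distrib_right)
  also have "x * x + x * x = 0" using assms(2) by (simp add: acomm_def eq_neg_iff_add_eq_0)
  finally show ?thesis by simp
qed

text \<open>
  The product of the elements indexed by a list, in the order of the list.
\<close>

definition word :: "('i \<Rightarrow> 'a::ring_1) \<Rightarrow> 'i list \<Rightarrow> 'a" where
  "word \<psi> xs = prod_list (map \<psi> xs)"

lemma word_simps [simp]:
  "word \<psi> [] = 1" "word \<psi> (x # xs) = \<psi> x * word \<psi> xs"
  "word \<psi> (xs @ ys) = word \<psi> xs * word \<psi> ys"
  by (simp_all add: word_def)

lemma word_map: "word \<psi> (map f xs) = word (\<lambda>k. \<psi> (f k)) xs"
  by (simp add: word_def comp_def)

lemma word_move:
  assumes "\<And>a. a \<in> set xs \<Longrightarrow> acomm (\<psi> a) y"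
  shows "word \<psi> xs * y = (-1) ^ length xs * (y * word \<psi> xs)"
  using assms
proof (induction xs)
  case (Cons x xs)
  have m: "(-1) ^ k * u = u * (-1) ^ k" for k and u :: 'b
    by (cases "even k") auto
  have "word \<psi> (x # xs) * y = \<psi> x * ((-1) ^ length xs * (y * word \<psi> xs))"
    using Cons by (simp add: mult.assoc)
  also have "\<dots> = (-1) ^ length xs * (\<psi> x * y * word \<psi> xs)"
    by (metis m mult.assoc)
  also have "\<dots> = (-1) ^ length (x # xs) * (y * word \<psi> (x # xs))"
    using Cons(2)[of x] by (simp add: acomm_def mult.assoc)
  finally show ?case .
qed simp

text \<open>
  Exchanging two letters of a word in anticommuting elements changes its sign, whatever stands
  between them: each of the two passes the letters in between, and the two signs cancel.
\<close>

lemma word_swap: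
  assumes "\<And>c. c \<in> set v \<Longrightarrow> acomm (\<psi> c) (\<psi> a)" "\<And>c. c \<in> set v \<Longrightarrow> acomm (\<psi> c) (\<psi> b)"
    and "acomm (\<psi> a) (\<psi> b)"
  shows "\<psi> a * (word \<psi> v * \<psi> b) = - (\<psi> b * (word \<psi> v * \<psi> a))"
proof -
  have m: "u * ((-1) ^ k * w) = (-1) ^ k * (u * w)" for k and u w :: 'b
    by (cases "even k") auto
  have "\<psi> a * (word \<psi> v * \<psi> b) = (-1) ^ length v * (\<psi> a * \<psi> b * word \<psi> v)"
    by (subst word_move) (simp_all add: assms m[of "\<psi> a"] mult.assoc)
  moreover have "\<psi> b * (word \<psi> v * \<psi> a) = (-1) ^ length v * (\<psi> b * \<psi> a * word \<psi> v)"
    by (subst word_move) (simp_all add: assms m[of "\<psi> b"] mult.assoc)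
  ultimately show ?thesis
    using assms(3) by (simp add: acomm_def)
qed

lemma word_not_distinct:
  assumes "\<And>a b. a \<in> set xs \<Longrightarrow> b \<in> set xs \<Longrightarrow> acomm (\<psi> a) (\<psi> b)"
    and "\<And>a. a \<in> set xs \<Longrightarrow> \<psi> a * \<psi> a = 0" and "\<not> distinct xs"
  shows "word \<psi> xs = 0"
proof -
  obtain u x v w where xs: "xs = u @ [x] @ v @ [x] @ w"
    using not_distinct_decomp[OF assms(3)] by blast
  have m: "u * ((-1) ^ k * w) = (-1) ^ k * (u * w)" for k and u w :: 'b
    by (cases "even k") auto
  have "\<psi> x * (word \<psi> v * \<psi> x) = (-1) ^ length v * (\<psi> x * \<psi> x * word \<psi> v)"
    by (subst word_move) (simp_all add: assms(1) xs m[of "\<psi> x"] mult.assoc)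
  then have "\<psi> x * (word \<psi> v * \<psi> x) = 0"
    using assms(2)[of x] by (simp add: xs)
  then have "\<psi> x * (word \<psi> v * (\<psi> x * word \<psi> w)) = 0"
    by (metis mult.assoc mult_zero_left)
  then show ?thesis
    by (simp add: xs)
qed

lemma word_transpose_ordered:
  assumes "\<And>c d. c \<in> set xs \<Longrightarrow> d \<in> set xs \<Longrightarrow> acomm (\<psi> c) (\<psi> d)"
    and "distinct xs" "xs = u @ [a] @ v @ [b] @ w"
  shows "word \<psi> (map (Transposition.transpose a b) xs) = - word \<psi> xs"
proof -
  have untouched: "map (Transposition.transpose a b) l = l" if "a \<notin> set l" "b \<notin> set l" for l
    using that by (intro map_idI) (metis transpose_apply_other)
  have *: "\<psi> a * (word \<psi> v * \<psi> b) = - (\<psi> b * (word \<psi> v * \<psi> a))"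
    by (rule word_swap) (simp_all add: assms)
  have "\<psi> a * (word \<psi> v * (\<psi> b * word \<psi> w)) = - (\<psi> b * (word \<psi> v * (\<psi> a * word \<psi> w)))"
    using arg_cong[OF *, of "\<lambda>t. t * word \<psi> w"] by (simp add: mult.assoc)
  then show ?thesis
    using assms(2) unfolding assms(3) by (simp add: untouched)
qed

lemma word_transpose:
  assumes "\<And>c d. c \<in> set xs \<Longrightarrow> d \<in> set xs \<Longrightarrow> acomm (\<psi> c) (\<psi> d)"
    and "distinct xs" "a \<in> set xs" "b \<in> set xs" "a \<noteq> b"
  shows "word \<psi> (map (Transposition.transpose a b) xs) = - word \<psi> xs"
proof -
  obtain u w where xs: "xs = u @ a # w"
    using assms(3) split_list by fast
  then consider "b \<in> set u" | "b \<in> set w"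
    using assms(4,5) by auto
  then show ?thesis
  proof cases
    case 1
    then obtain u' v where "u = u' @ b # v"
      using split_list by fast
    then have "xs = u' @ [b] @ v @ [a] @ w"
      using xs by simp
    from word_transpose_ordered[OF assms(1,2) this] show ?thesis
      by (simp only: transpose_commute)
  next
    case 2
    then obtain v w' where "w = v @ b # w'"
      using split_list by fast
    then have "xs = u @ [a] @ v @ [b] @ w'"
      using xs by simp
    from word_transpose_ordered[OF assms(1,2) this] show ?thesis .
  qed
qed

text \<open>
  This is where the signs in the column-determinant come from. The transposition acts on the
  letters, not on their positions.
\<close>

lemma word_permutes:
  assumes "\<And>c d. c < N \<Longrightarrow> d < N \<Longrightarrow> acomm (\<psi> c) (\<psi> d)" and "\<sigma> permutes {0..<N}"
  shows "word \<psi> (map \<sigma> [0..<N]) = of_int (sign \<sigma>) * word \<psi> [0..<N]"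
  using assms(2) finite_atLeastLessThan[of 0 N]
proof (induction rule: permutes_induct)
  case id
  show ?case by (simp only: sign_id list.map_id of_int_1 mult_1_left)
next
  case (swap a b p)
  have p: "set (map p [0..<N]) = {0..<N}" "distinct (map p [0..<N])"
    using permutes_image[OF swap(4)] permutes_inj_on[OF swap(4)]
    by (simp_all only: set_map set_upt distinct_map distinct_upt simp_thms)
  have *: "sign (Transposition.transpose a b \<circ> p) = - sign p"
    using sign_compose[OF permutation_swap_id permutes_imp_permutation[OF finite_atLeastLessThan swap(4)], of a b]
      swap(3) by (simp only: sign_swap_id if_False mult_minus_left mult_1_left)
  have "word \<psi> (map (Transposition.transpose a b \<circ> p) [0..<N])
      = word \<psi> (map (Transposition.transpose a b) (map p [0..<N]))"
    by (simp only: map_map)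
  also have "\<dots> = - word \<psi> (map p [0..<N])"
  proof (rule word_transpose)
    show "acomm (\<psi> c) (\<psi> d)" if "c \<in> set (map p [0..<N])" "d \<in> set (map p [0..<N])" for c d
      using that assms(1) unfolding p by auto
  qed (use p swap(1-3) in auto)
  also have "\<dots> = of_int (- sign p) * word \<psi> [0..<N]"
    by (simp only: swap(5) of_int_minus mult_minus_left)
  finally show ?case
    using * by (simp only:)
qed

lemma word_permute_list:
  assumes "\<And>c d. c \<in> set xs \<Longrightarrow> d \<in> set xs \<Longrightarrow> acomm (\<psi> c) (\<psi> d)"
    and "\<sigma> permutes {0..<length xs}"
  shows "word \<psi> (permute_list \<sigma> xs) = of_int (sign \<sigma>) * word \<psi> xs"
proof -
  have "word (\<lambda>k. \<psi> (xs ! k)) (map \<sigma> [0..<length xs])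
      = of_int (sign \<sigma>) * word (\<lambda>k. \<psi> (xs ! k)) [0..<length xs]"
    by (rule word_permutes) (use assms in auto)
  moreover have "word (\<lambda>k. \<psi> (xs ! k)) [0..<length xs] = word \<psi> xs"
    by (metis map_nth word_map)
  ultimately show ?thesis
    by (simp add: permute_list_def word_map)
qed

section \<open>Column-determinants as products of anticommuting sums\<close>

lemma prod_sum_expand:
  fixes \<psi> :: "nat \<Rightarrow> 'a::ring_1" and M :: "nat \<Rightarrow> nat \<Rightarrow> 'a"
  assumes "\<And>p p' k. p < P \<Longrightarrow> p' < P \<Longrightarrow> k < N \<Longrightarrow> comm (M p k) (\<psi> p')"
  shows "prod_list (map (\<lambda>k. \<Sum>p<P. \<psi> p * M p k) [0..<N])
    = (\<Sum>xs | length xs = N \<and> set xs \<subseteq> {0..<P}.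
        word \<psi> xs * prod_list (map (\<lambda>k. M (xs ! k) k) [0..<N]))"
  using assms
proof (induction N)
  case 0
  have "{xs. length xs = 0 \<and> set xs \<subseteq> {0..<P}} = {[]}" by auto
  then show ?case by simp
next
  case (Suc N)
  let ?A = "\<lambda>N. {xs. length xs = N \<and> set xs \<subseteq> {0..<P}}"
  let ?m = "\<lambda>xs. prod_list (map (\<lambda>k. M (xs ! k) k) [0..<N])"
  have c: "comm (?m xs) (\<psi> p)" if "xs \<in> ?A N" "p < P" for xs p
  proof -
    have "comm (prod_list (map (\<lambda>k. M (xs ! k) k) ks)) (\<psi> p)" if "set ks \<subseteq> {0..<N}" for ks
      using that
    proof (induction ks)
      case (Cons k ks)
      have "xs ! k \<in> set xs" using \<open>xs \<in> ?A N\<close> Cons(2) by auto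
      then have "xs ! k < P" using \<open>xs \<in> ?A N\<close> by auto
      then show ?case
        using Cons Suc.prems[of "xs ! k" p k] \<open>p < P\<close> by (auto intro: comm_mult_left)
    qed (simp add: comm_def)
    then show ?thesis by simp
  qed
  have "prod_list (map (\<lambda>k. \<Sum>p<P. \<psi> p * M p k) [0..<Suc N])
      = (\<Sum>xs\<in>?A N. word \<psi> xs * ?m xs) * (\<Sum>p<P. \<psi> p * M p N)"
    using Suc by simp
  also have "\<dots> = (\<Sum>(xs, p)\<in>?A N \<times> {..<P}. word \<psi> xs * ?m xs * (\<psi> p * M p N))"
    unfolding sum_product sum.cartesian_product ..
  also have "\<dots> = (\<Sum>(xs, p)\<in>?A N \<times> {..<P}. word \<psi> (xs @ [p]) * (?m xs * M p N))"
  proof (rule sum.cong[OF refl])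
    fix xp assume "xp \<in> ?A N \<times> {..<P}"
    then obtain xs p where xp: "xp = (xs, p)" "xs \<in> ?A N" "p < P" by auto
    then have "?m xs * \<psi> p = \<psi> p * ?m xs"
      using c[of xs p] by (simp add: comm_def)
    then have "word \<psi> xs * (?m xs * \<psi> p) * M p N = word \<psi> xs * (\<psi> p * ?m xs) * M p N"
      by (simp only:)
    then show "(case xp of (xs, p) \<Rightarrow> word \<psi> xs * ?m xs * (\<psi> p * M p N))
        = (case xp of (xs, p) \<Rightarrow> word \<psi> (xs @ [p]) * (?m xs * M p N))"
      by (simp only: xp prod.case word_simps mult.assoc mult_1_right)
  qed
  also have "\<dots> = (\<Sum>xs\<in>?A (Suc N). word \<psi> xs * prod_list (map (\<lambda>k. M (xs ! k) k) [0..<Suc N]))"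
  proof (rule sum.reindex_bij_witness[where i = "\<lambda>xs. (butlast xs, last xs)" and j = "\<lambda>(xs, p). xs @ [p]"])
    fix xs assume xs: "xs \<in> ?A (Suc N)"
    then have "xs \<noteq> []" by auto
    moreover from this have "last xs \<in> {0..<P}"
      using xs subsetD[OF _ last_in_set, of xs] by blast
    ultimately show "(case (butlast xs, last xs) of (xs, p) \<Rightarrow> xs @ [p]) = xs"
      "(butlast xs, last xs) \<in> ?A N \<times> {..<P}"
      using xs by (auto dest: in_set_butlastD)
  next
    fix xp assume "xp \<in> ?A N \<times> {..<P}"
    then obtain xs p where xp: "xp = (xs, p)" and x: "length xs = N" "set xs \<subseteq> {0..<P}" "p < P" by auto
    have "?m (xs @ [p]) = ?m xs" using x by (intro arg_cong[of _ _ prod_list]) (auto simp: nth_append)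
    then show "word \<psi> (case xp of (xs, p) \<Rightarrow> xs @ [p])
        * prod_list (map (\<lambda>k. M ((case xp of (xs, p) \<Rightarrow> xs @ [p]) ! k) k) [0..<Suc N])
      = (case xp of (xs, p) \<Rightarrow> word \<psi> (xs @ [p]) * (?m xs * M p N))"
      using x by (simp add: xp nth_append mult.assoc)
  qed auto
  finally show ?case .
qed

lemma increasing_indices_unique:
  assumes "L \<in> increasing_indices N P" "L' \<in> increasing_indices N P" "mset L = mset L'"
  shows "L = L'"
  using assms
  by (metis (mono_tags, lifting) increasing_indices_def mem_Collect_eq properties_for_sort
      sorted_wrt_mono_rel less_imp_le strict_sorted_iff)

lemma length_increasing: "L \<in> increasing_indices k N \<Longrightarrow> length L = k"
  "L \<in> increasing_indices k N \<Longrightarrow> a < k \<Longrightarrow> L ! a < N"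
  by (auto simp: increasing_indices_def subset_iff)

lemma increasing_indices_full: "increasing_indices N N = {[0..<N]}"
proof -
  have "L = [0..<N]" if "L \<in> increasing_indices N N" for L
  proof -
    have L: "length L = N" "sorted L" "distinct L" "set L \<subseteq> {0..<N}"
      using that by (auto simp: increasing_indices_def strict_sorted_iff)
    then have "set L = {0..<N}"
      by (metis card_atLeastLessThan card_subset_eq diff_zero distinct_card finite_atLeastLessThan)
    then show ?thesis
      using L by (metis sorted_list_of_set_range sorted_distinct_set_unique distinct_upt set_upt sorted_upt)
  qed
  then show ?thesis by (auto simp: increasing_indices_def)
qed

text \<open>
  A non-commutative Cauchy-Binet expansion: only the words without repetition survive, and those with
  the same set of letters combine to one column-determinant.
\<close>

lemma prod_sum_col_det:
  fixes \<psi> :: "nat \<Rightarrow> 'a::ring_1" and M :: "nat \<Rightarrow> nat \<Rightarrow> 'a"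
  assumes comm: "\<And>p p' k. p < P \<Longrightarrow> p' < P \<Longrightarrow> k < N \<Longrightarrow> comm (M p k) (\<psi> p')"
    and ac: "\<And>p p'. p < P \<Longrightarrow> p' < P \<Longrightarrow> acomm (\<psi> p) (\<psi> p')"
    and sq: "\<And>p. p < P \<Longrightarrow> \<psi> p * \<psi> p = 0"
  shows "prod_list (map (\<lambda>k. \<Sum>p<P. \<psi> p * M p k) [0..<N])
    = (\<Sum>L\<in>increasing_indices N P. word \<psi> L * col_det (mat N N (\<lambda>(a, k). M (L ! a) k)))"
proof -
  let ?A = "{xs. length xs = N \<and> set xs \<subseteq> {0..<P}}"
  let ?S = "{\<sigma>. \<sigma> permutes {0..<N}}"
  let ?m = "\<lambda>xs. prod_list (map (\<lambda>k. M (xs ! k) k) [0..<N])"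
  let ?I = "increasing_indices N P"
  have I: "length L = N" "sorted L" "distinct L" "set L \<subseteq> {0..<P}" if "L \<in> ?I" for L
    using that by (auto simp: increasing_indices_def strict_sorted_iff)
  have bij: "bij_betw (\<lambda>(L, \<sigma>). permute_list \<sigma> L) (?I \<times> ?S) {xs \<in> ?A. distinct xs}"
    unfolding bij_betw_def
  proof
    show "inj_on (\<lambda>(L, \<sigma>). permute_list \<sigma> L) (?I \<times> ?S)"
    proof (rule inj_onI, safe)
      fix L \<sigma> L' \<sigma>'
      assume L: "L \<in> ?I" "L' \<in> ?I" and s: "\<sigma> permutes {0..<N}" "\<sigma>' permutes {0..<N}"
        and eq: "permute_list \<sigma> L = permute_list \<sigma>' L'"
      have "mset L = mset L'"
        using eq s I(1) L by (metis mset_permute_list lessThan_atLeast0)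
      then show LL: "L = L'"
        by (rule increasing_indices_unique[OF L])
      show "\<sigma> = \<sigma>'"
      proof
        fix k
        show "\<sigma> k = \<sigma>' k"
        proof (cases "k < N")
          case True
          then have "L ! \<sigma> k = L ! \<sigma>' k"
            using eq[unfolded LL[symmetric]] I(1)[OF L(1)] s
            by (metis permute_list_nth lessThan_atLeast0)
          then show ?thesis
            using I(1,3)[OF L(1)] s True
            by (metis atLeastLessThan_iff nth_eq_iff_index_eq permutes_in_image zero_le)
        qed (use s in \<open>simp add: permutes_not_in\<close>)
      qed
    qed
    show "(\<lambda>(L, \<sigma>). permute_list \<sigma> L) ` (?I \<times> ?S) = {xs \<in> ?A. distinct xs}"
    proof (intro subset_antisym subsetI)
      fix xs assume "xs \<in> (\<lambda>(L, \<sigma>). permute_list \<sigma> L) ` (?I \<times> ?S)"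
      then obtain L \<sigma> where "xs = permute_list \<sigma> L" "L \<in> ?I" "\<sigma> permutes {0..<N}"
        by auto
      then show "xs \<in> {xs \<in> ?A. distinct xs}"
        using I[of L] set_permute_list[of \<sigma> L] by (auto simp: lessThan_atLeast0)
    next
      fix xs assume xs: "xs \<in> {xs \<in> ?A. distinct xs}"
      have "mset xs = mset (sort xs)" by simp
      then obtain \<sigma> where "\<sigma> permutes {..<length (sort xs)}" "permute_list \<sigma> (sort xs) = xs"
        by (rule mset_eq_permutation)
      moreover have "sort xs \<in> ?I"
        using xs by (auto simp: increasing_indices_def strict_sorted_iff)
      ultimately show "xs \<in> (\<lambda>(L, \<sigma>). permute_list \<sigma> L) ` (?I \<times> ?S)"
        using xs by (intro image_eqI[where x = "(sort xs, \<sigma>)"]) (auto simp: lessThan_atLeast0)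
    qed
  qed
  have "prod_list (map (\<lambda>k. \<Sum>p<P. \<psi> p * M p k) [0..<N]) = (\<Sum>xs\<in>?A. word \<psi> xs * ?m xs)"
    by (rule prod_sum_expand) (rule comm)
  also have "\<dots> = (\<Sum>xs | xs \<in> ?A \<and> distinct xs. word \<psi> xs * ?m xs)"
  proof (rule sum.mono_neutral_right)
    show "finite ?A"
      using finite_lists_length_eq[of "{0..<P}" N] by (simp add: conj_commute)
    have "word \<psi> xs = 0" if "xs \<in> ?A" "\<not> distinct xs" for xs
      by (rule word_not_distinct) (use that ac sq in \<open>auto simp: subset_iff\<close>)
    then show "\<forall>xs\<in>?A - {xs. xs \<in> ?A \<and> distinct xs}. word \<psi> xs * ?m xs = 0"
      by auto
  qed auto
  also have "\<dots> = (\<Sum>(L, \<sigma>)\<in>?I \<times> ?S. word \<psi> (permute_list \<sigma> L) * ?m (permute_list \<sigma> L))"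
    using sum.reindex_bij_betw[OF bij, of "\<lambda>xs. word \<psi> xs * ?m xs"] by (simp add: case_prod_beta)
  also have "\<dots> = (\<Sum>L\<in>?I. \<Sum>\<sigma>\<in>?S. word \<psi> (permute_list \<sigma> L) * ?m (permute_list \<sigma> L))"
    by (simp add: sum.cartesian_product)
  also have "\<dots> = (\<Sum>L\<in>?I. word \<psi> L * col_det (mat N N (\<lambda>(a, k). M (L ! a) k)))"
  proof (rule sum.cong)
    fix L assume L: "L \<in> ?I"
    have "word \<psi> (permute_list \<sigma> L) * ?m (permute_list \<sigma> L)
      = word \<psi> L * (of_int (sign \<sigma>) *
          prod_list (map (\<lambda>k. mat N N (\<lambda>(a, k). M (L ! a) k) $$ (\<sigma> k, k)) [0..<N]))"
      if s: "\<sigma> \<in> ?S" for \<sigma>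
    proof -
      have "word \<psi> (permute_list \<sigma> L) = of_int (sign \<sigma>) * word \<psi> L"
        by (rule word_permute_list) (use ac I[OF L] s in \<open>auto simp: subset_iff\<close>)
      moreover have "?m (permute_list \<sigma> L)
          = prod_list (map (\<lambda>k. mat N N (\<lambda>(a, k). M (L ! a) k) $$ (\<sigma> k, k)) [0..<N])"
      proof (intro arg_cong[of _ _ prod_list] map_cong refl)
        fix k assume "k \<in> set [0..<N]"
        moreover have "\<sigma> k < N" if "k < N" for k
          using permutes_in_image[of \<sigma> "{0..<N}" k] s that by auto
        ultimately show "M (permute_list \<sigma> L ! k) k = mat N N (\<lambda>(a, k). M (L ! a) k) $$ (\<sigma> k, k)"
          using I(1)[OF L] s by (simp add: permute_list_nth lessThan_atLeast0)
      qed
      ultimately show ?thesis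
        by (simp add: sign_def)
    qed
    then show "(\<Sum>\<sigma>\<in>?S. word \<psi> (permute_list \<sigma> L) * ?m (permute_list \<sigma> L))
      = word \<psi> L * col_det (mat N N (\<lambda>(a, k). M (L ! a) k))"
      by (simp add: col_det_def sum_distrib_left)
  qed simp
  finally show ?thesis .
qed

section \<open>Operators on Fock space\<close>

text \<open>
  A function \<open>u\<close> on sets of indices stands for the formal sum \<open>\<Sum>\<^sub>S u(S) e\<^sub>S\<close>, where \<open>e\<^sub>S\<close> is the
  exterior product of the generators with index in \<open>S\<close>, in increasing order; infinite \<open>S\<close> play no
  role, since they are not reached from the vacuum. The operators are the
  additive maps that are linear over the centre of the coefficient ring, so that multiplication
  by a central coefficient is a central operator (\<open>lmult_central\<close>).
\<close>

definition fock_endos :: "((nat set \<Rightarrow> 'a::ring_1) \<Rightarrow> (nat set \<Rightarrow> 'a)) set" where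
  "fock_endos = {f. (\<forall>u v. f (\<lambda>S. u S + v S) = (\<lambda>S. f u S + f v S)) \<and>
     (\<forall>c u. (\<forall>x. c * x = x * c) \<longrightarrow> f (\<lambda>S. c * u S) = (\<lambda>S. c * f u S))}"

typedef (overloaded) 'a fock_op = "fock_endos :: ((nat set \<Rightarrow> 'a::ring_1) \<Rightarrow> (nat set \<Rightarrow> 'a)) set"
  morphisms app Abs_fock_op
  by (rule exI[of _ "\<lambda>u. u"]) (simp add: fock_endos_def)

setup_lifting type_definition_fock_op

lemma fock_endos_add: "f \<in> fock_endos \<Longrightarrow> f (\<lambda>S. u S + v S) = (\<lambda>S. f u S + f v S)"
  by (simp add: fock_endos_def)

lemma fock_endos_scale:
  "f \<in> fock_endos \<Longrightarrow> (\<And>x. c * x = x * c) \<Longrightarrow> f (\<lambda>S. c * u S) = (\<lambda>S. c * f u S)"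
  by (simp add: fock_endos_def)

lemma fock_endos_zero: "f \<in> fock_endos \<Longrightarrow> f (\<lambda>S. 0) = (\<lambda>S. 0)"
  using fock_endos_scale[of f 0 "\<lambda>S. 0"] by simp

instantiation fock_op :: (ring_1) ring_1
begin

lift_definition zero_fock_op :: "'a fock_op" is "\<lambda>u S. 0"
  by (simp add: fock_endos_def)

lift_definition one_fock_op :: "'a fock_op" is "\<lambda>u. u"
  by (simp add: fock_endos_def)

lift_definition plus_fock_op :: "'a fock_op \<Rightarrow> 'a fock_op \<Rightarrow> 'a fock_op" is "\<lambda>f g u S. f u S + g u S"
  by (simp add: fock_endos_def fun_eq_iff algebra_simps)

lift_definition uminus_fock_op :: "'a fock_op \<Rightarrow> 'a fock_op" is "\<lambda>f u S. - f u S"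
  by (simp add: fock_endos_def fun_eq_iff algebra_simps)

lift_definition minus_fock_op :: "'a fock_op \<Rightarrow> 'a fock_op \<Rightarrow> 'a fock_op" is "\<lambda>f g u S. f u S - g u S"
  by (simp add: fock_endos_def fun_eq_iff algebra_simps)

lift_definition times_fock_op :: "'a fock_op \<Rightarrow> 'a fock_op \<Rightarrow> 'a fock_op" is "\<lambda>f g u. f (g u)"
  by (simp add: fock_endos_def)

instance
proof
  show "(0 :: 'a fock_op) \<noteq> 1"
  proof
    assume "(0 :: 'a fock_op) = 1"
    then have "app (0 :: 'a fock_op) (\<lambda>S. 1) {} = app 1 (\<lambda>S. 1) {}" by simp
    then show False by (simp add: zero_fock_op.rep_eq one_fock_op.rep_eq)
  qed
qed (transfer; simp add: fun_eq_iff algebra_simps fock_endos_add)+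

end

text \<open>
  The sign that arises when the generator \<open>p\<close> is moved from the front to its place in \<open>e\<^sub>S\<close>.
\<close>

definition lower_sign :: "nat \<Rightarrow> nat set \<Rightarrow> 'a::ring_1" where
  "lower_sign p S = (-1) ^ card {q \<in> S. q < p}"

lemma lower_sign_comm: "lower_sign p S * x = x * lower_sign p S"
  by (cases "even (card {q \<in> S. q < p})") (simp_all add: lower_sign_def)

lemma lower_sign_remove_above: "p \<le> q \<Longrightarrow> lower_sign p (S - {q}) = lower_sign p S"
proof -
  assume "p \<le> q"
  then have "{x \<in> S - {q}. x < p} = {x \<in> S. x < p}" by auto
  then show ?thesis by (simp only: lower_sign_def)
qed

lemma lower_sign_remove_below:
  assumes "q < p" "q \<in> S"
  shows "lower_sign p (S - {q}) = - lower_sign p S"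
proof -
  have "{x \<in> S. x < p} = insert q {x \<in> S - {q}. x < p}" using assms by auto
  moreover have "q \<notin> {x \<in> S - {q}. x < p}" "finite {x \<in> S - {q}. x < p}"
    by auto
  ultimately have "card {x \<in> S. x < p} = Suc (card {x \<in> S - {q}. x < p})"
    by (metis card_insert_disjoint)
  then show ?thesis by (simp add: lower_sign_def)
qed

text \<open>
  Exterior multiplication by the generator with index \<open>p\<close>.
\<close>

lift_definition gen :: "nat \<Rightarrow> 'a::ring_1 fock_op" is
  "\<lambda>p u S. if p \<in> S then lower_sign p S * u (S - {p}) else 0"
  by (auto simp: fock_endos_def fun_eq_iff algebra_simps)

text \<open>
  Multiplication of all coefficients from the left and, below, from the right. The right
  multiplications commute with the left ones but compose in the opposite order.
\<close>

lift_definition lmult :: "'a::ring_1 \<Rightarrow> 'a fock_op" is "\<lambda>c u S. c * u S"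
  by (auto simp: fock_endos_def fun_eq_iff algebra_simps)

lift_definition rmult :: "'a::ring_1 \<Rightarrow> 'a fock_op" is "\<lambda>c u S. u S * c"
  by (auto simp: fock_endos_def fun_eq_iff algebra_simps)

lemma gen_sq: "gen p * gen p = 0"
  by transfer (simp add: fun_eq_iff)

lemma gen_acomm_less: "p < q \<Longrightarrow> acomm (gen p) (gen q)"
  unfolding acomm_def
  by transfer
    (auto simp: fun_eq_iff lower_sign_remove_above lower_sign_remove_below Diff_insert2 [symmetric]
      lower_sign_comm mult.assoc[symmetric] insert_commute)

lemma gen_acomm: "acomm (gen p) (gen q)"
proof (cases p q rule: linorder_cases)
  case equal
  then show ?thesis by (simp add: acomm_def gen_sq)
qed (auto intro: gen_acomm_less acomm_sym)

lemma gen_comm_lmult: "comm (gen p) (lmult c)"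
  unfolding comm_def by transfer (auto simp: fun_eq_iff lower_sign_comm mult.assoc)

lemma gen_comm_rmult: "comm (gen p) (rmult c)"
  unfolding comm_def by transfer (auto simp: fun_eq_iff mult.assoc)

lemma lmult_comm_rmult: "comm (lmult c) (rmult d)"
  unfolding comm_def by transfer (auto simp: fun_eq_iff mult.assoc)

lemma lmult_add: "lmult (c + d) = lmult c + lmult d"
  by transfer (simp add: fun_eq_iff algebra_simps)

lemma lmult_minus: "lmult (- c) = - lmult c"
  by transfer (simp add: fun_eq_iff)

lemma lmult_mult: "lmult (c * d) = lmult c * lmult d"
  by transfer (simp add: fun_eq_iff mult.assoc)

lemma lmult_0: "lmult 0 = 0"
  by transfer simp

lemma lmult_1: "lmult 1 = 1"
  by transfer simp

lemma lmult_sum: "lmult (sum f A) = (\<Sum>k\<in>A. lmult (f k))"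
  by (induction A rule: infinite_finite_induct) (simp_all add: lmult_add lmult_0)

lemma rmult_add: "rmult (c + d) = rmult c + rmult d"
  by transfer (simp add: fun_eq_iff algebra_simps)

lemma rmult_minus: "rmult (- c) = - rmult c"
  by transfer (simp add: fun_eq_iff)

lemma rmult_mult: "rmult (c * d) = rmult d * rmult c"
  by transfer (simp add: fun_eq_iff mult.assoc)

lemma rmult_1: "rmult 1 = 1"
  by transfer simp

lemma lmult_central:
  assumes "\<And>x. c * x = x * c"
  shows "lmult c * X = X * lmult c"
  using assms by transfer (rule ext, rule fock_endos_scale[symmetric])

lemma lmult_eq_rmult: "(\<And>x. c * x = x * c) \<Longrightarrow> lmult c = rmult c"
  by transfer simp

section \<open>The vacuum and the odd degree\<close>

text \<open>
  The vacuum is the coefficient \<open>1\<close> at the empty set. \<open>ann\<close> is the left ideal of the operators that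
  annihilate it.
\<close>

definition vac :: "nat set \<Rightarrow> 'a::ring_1" where
  "vac S = (if S = {} then 1 else 0)"

definition ann :: "'a::ring_1 fock_op set" where
  "ann = {X. app X vac = (\<lambda>S. 0)}"

text \<open>
  The operators that send the vacuum to a combination of monomials with at least \<open>k\<close> generators
  of odd index; these will be the generators \<open>\<theta>'\<close>. Finiteness of \<open>S\<close> is demanded because the
  cardinality of an infinite set is \<open>0\<close> by convention.
\<close>

definition odd_degree_ge :: "nat \<Rightarrow> 'a::ring_1 fock_op set" where
  "odd_degree_ge k = {X. \<forall>S. app X vac S \<noteq> 0 \<longrightarrow> finite S \<and> k \<le> card {p \<in> S. odd p}}"

lemma app_simps:
  "app 0 u S = 0" "app 1 u S = u S" "app (X + Y) u S = app X u S + app Y u S"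
  "app (- X) u S = - app X u S" "app (X - Y) u S = app X u S - app Y u S"
  "app (X * Y) u S = app X (app Y u) S" "app (lmult c) u S = c * u S" "app (rmult c) u S = u S * c"
  by (transfer; simp)+

lemma ann_0: "0 \<in> ann"
  by (simp add: ann_def zero_fock_op.rep_eq)

lemma ann_add: "X \<in> ann \<Longrightarrow> Y \<in> ann \<Longrightarrow> X + Y \<in> ann"
  by (simp add: ann_def fun_eq_iff app_simps)

lemma ann_mult: "X \<in> ann \<Longrightarrow> Y * X \<in> ann"
  by (simp add: ann_def times_fock_op.rep_eq) (metis fock_endos_zero app)

text \<open>
  On the vacuum, left and right multiplication cannot be distinguished; this starts the comparison of
  the two products.
\<close>

lemma lmult_rmult_ann: "lmult c - rmult c \<in> ann"
  by (simp add: ann_def fun_eq_iff app_simps vac_def)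

lemma odd_degree_ge_ann: "X \<in> ann \<Longrightarrow> X \<in> odd_degree_ge k"
  by (simp add: ann_def odd_degree_ge_def)

lemma odd_degree_ge_1: "1 \<in> odd_degree_ge 0"
  by (auto simp: odd_degree_ge_def app_simps vac_def)

lemma odd_degree_ge_add: "X \<in> odd_degree_ge k \<Longrightarrow> Y \<in> odd_degree_ge k \<Longrightarrow> X + Y \<in> odd_degree_ge k"
  unfolding odd_degree_ge_def mem_Collect_eq app_simps by (metis add.right_neutral)

lemma odd_degree_ge_mono: "X \<in> odd_degree_ge k \<Longrightarrow> l \<le> k \<Longrightarrow> X \<in> odd_degree_ge l"
  unfolding odd_degree_ge_def mem_Collect_eq by (meson le_trans)

lemma odd_degree_ge_lmult: "X \<in> odd_degree_ge k \<Longrightarrow> lmult c * X \<in> odd_degree_ge k"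
  unfolding odd_degree_ge_def mem_Collect_eq app_simps by (metis mult_zero_right)

lemma odd_degree_ge_rmult: "X \<in> odd_degree_ge k \<Longrightarrow> rmult c * X \<in> odd_degree_ge k"
  unfolding odd_degree_ge_def mem_Collect_eq app_simps by (metis mult_zero_left)

lemma odd_degree_ge_gen: "X \<in> odd_degree_ge k \<Longrightarrow> gen p * X \<in> odd_degree_ge (k + of_bool (odd p))"
proof -
  assume X: "X \<in> odd_degree_ge k"
  have "finite S \<and> k + of_bool (odd p) \<le> card {q \<in> S. odd q}" if "app (gen p * X) vac S \<noteq> 0" for S
  proof -
    have p: "p \<in> S" and "app X vac (S - {p}) \<noteq> 0"
      using that by (auto simp: times_fock_op.rep_eq gen.rep_eq split: if_splits)
    then have S: "finite (S - {p})" "k \<le> card {q \<in> S - {p}. odd q}"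
      using X by (auto simp: odd_degree_ge_def)
    have "{q \<in> S. odd q} = (if odd p then insert p {q \<in> S - {p}. odd q} else {q \<in> S - {p}. odd q})"
      using p by auto
    moreover have "finite {q \<in> S - {p}. odd q}"
      using S(1) by simp
    ultimately have "card {q \<in> S. odd q} = card {q \<in> S - {p}. odd q} + of_bool (odd p)"
      by simp
    then show ?thesis
      using S by simp
  qed
  then show ?thesis by (simp add: odd_degree_ge_def)
qed

text \<open>
  Only \<open>r\<close> of the indices below \<open>2 * r\<close> are odd.
\<close>

lemma odd_degree_ge_top:
  assumes "X \<in> odd_degree_ge (Suc r)"
  shows "app X vac {0..<2 * r} = 0"
proof (rule ccontr)
  assume "app X vac {0..<2 * r} \<noteq> 0"
  then have "Suc r \<le> card {p \<in> {0..<2 * r}. odd p}"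
    using assms unfolding odd_degree_ge_def by blast
  moreover have "{p \<in> {0..<2 * r}. odd p} = (\<lambda>a. 2 * a + 1) ` {0..<r}"
    by (auto elim!: oddE)
  then have "card {p \<in> {0..<2 * r}. odd p} \<le> r"
    by (metis card_atLeastLessThan card_image_le diff_zero finite_atLeastLessThan)
  ultimately show False by simp
qed

lemma app_word_gen: "k \<le> N \<Longrightarrow> app (word gen [k..<N]) vac {k..<N} = (1 :: 'a::ring_1)"
proof (induction rule: inc_induct)
  case base
  show ?case by (simp add: app_simps vac_def)
next
  case (step k)
  have e: "{k..<N} - {k} = {Suc k..<N}" "{q. k \<le> q \<and> q < N \<and> q < k} = {}" by auto
  show ?case
    using step by (simp add: upt_conv_Cons app_simps gen.rep_eq lower_sign_def e)
qed

section \<open>Normal ordering for two families\<close>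

text \<open>
  The product of two elements \<open>u\<close>, \<open>w\<close> in terms of \<open>A = u + i w\<close> and \<open>B = u - i w\<close>, with \<open>i\<close> for
  the imaginary unit and \<open>h\<close> for \<open>1/2\<close>: \<open>u w = - h\<^sup>2 i (A + B) (A - B)\<close>.
\<close>

lemma real_pair_product:
  fixes i h :: "'a::ring_1"
  assumes "\<And>x. i * x = x * i" "i * i = -1" "\<And>x. h * x = x * h" "h + h = 1"
    and "(u + i * w + (u - i * w)) * (u + i * w - (u - i * w)) = - (y + y) - z"
  shows "u * w = h * i * y + h * (h * i) * z"
proof -
  have half: "h * (x + x) = x" for x
    by (metis assms(4) distrib_left distrib_right mult_1_left)
  have "(u + i * w + (u - i * w)) * (u + i * w - (u - i * w)) = (u + u) * (i * w + i * w)"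
    by simp
  also have "\<dots> = (u * (i * w) + u * (i * w)) + (u * (i * w) + u * (i * w))"
    by (simp add: algebra_simps)
  also have "u * (i * w) = i * (u * w)"
    using assms(1)[of u] by (simp flip: mult.assoc)
  finally have "i * (u * w) + i * (u * w) + (i * (u * w) + i * (u * w)) = - (y + y) - z"
    by (simp only: assms(5))
  moreover have "i * (u * w) = h * (h * (i * (u * w) + i * (u * w) + (i * (u * w) + i * (u * w))))"
    by (simp only: half)
  ultimately have "i * (u * w) = h * (h * (- (y + y) - z))"
    by (simp only:)
  then have "- (i * (i * (u * w))) = - (i * (h * (h * (- (y + y) - z))))"
    by simp
  also have "- (i * (i * (u * w))) = u * w"
    using assms(2) by (simp flip: mult.assoc)
  also have "- (i * (h * (h * (- (y + y) - z)))) = i * (h * (h * (y + y))) + i * (h * (h * z))"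
    by (simp add: algebra_simps)
  also have "\<dots> = i * (h * y) + i * (h * (h * z))"
    by (simp only: half)
  also have "\<dots> = h * i * y + h * (h * i) * z"
    using assms(1)[of h] assms(3)[of "h * i"] by (simp add: mult.assoc[symmetric])
  finally show ?thesis .
qed

text \<open>
  The operator \<open>a - \<alpha> + k q\<close> measures how far \<open>a + k q\<close> is from \<open>\<alpha>\<close>. Moving it past one more
  factor \<open>y = \<alpha>\<^sub>j\<close> raises the shift \<open>k\<close> by one; moving it past a factor of the conjugate family leaves
  \<open>k\<close> unchanged.
\<close>

lemma capelli_defect_step:
  fixes a \<alpha> q y :: "'a::ring_1"
  assumes "a * y = - (y * a) - q * y" "acomm \<alpha> y" "acomm q y"
  shows "(a - \<alpha> + of_nat (Suc k) * q) * y = - (y * (a - \<alpha> + of_nat k * q))"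
  using assms by (simp add: acomm_def mult_of_nat_left algebra_simps)

lemma capelli_defect_cross:
  fixes a \<alpha> q y :: "'a::ring_1"
  assumes "acomm a y" "acomm \<alpha> y" "acomm q y"
  shows "(a - \<alpha> + of_nat k * q) * y = - (y * (a - \<alpha> + of_nat k * q))"
  using assms by (simp add: acomm_def mult_of_nat_left algebra_simps)

text \<open>
  What the comparison of the two products needs. Here \<open>a\<close>, \<open>\<alpha>\<close>, \<open>q\<close> are the columns with derivatives
  multiplied from the left, those with derivatives multiplied from the right, and the columns
  of \<open>Q\<close>; the primed letters are their conjugates. \<open>N\<close> is the left ideal that annihilates the vacuum,
  and \<open>G k\<close> consists of the elements that take the vacuum to degree at least \<open>k\<close> in the generators
  of the primed family.
\<close>

locale two_capelli_families =
  fixes i h :: "'a::ring_1" and N :: "'a set" and G :: "nat \<Rightarrow> 'a set" and r :: nat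
    and a \<alpha> q a' \<alpha>' q' :: "nat \<Rightarrow> 'a"
  assumes i_central: "i * x = x * i" and i_sq: "i * i = -1"
    and h_central: "h * x = x * h" and h_half: "h + h = 1"
    and N_0: "0 \<in> N" and N_add: "x \<in> N \<Longrightarrow> y \<in> N \<Longrightarrow> x + y \<in> N"
    and N_mult: "x \<in> N \<Longrightarrow> y * x \<in> N"
    and G_1: "1 \<in> G 0" and G_N: "x \<in> N \<Longrightarrow> x \<in> G k"
    and G_add: "x \<in> G k \<Longrightarrow> y \<in> G k \<Longrightarrow> x + y \<in> G k"
    and G_mono: "x \<in> G (Suc k) \<Longrightarrow> x \<in> G k"
    and G_i: "x \<in> G k \<Longrightarrow> i * x \<in> G k" and G_h: "x \<in> G k \<Longrightarrow> h * x \<in> G k"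
    and G_keep: "m < r \<Longrightarrow> x \<in> G k \<Longrightarrow> a m * x \<in> G k" "m < r \<Longrightarrow> x \<in> G k \<Longrightarrow> \<alpha> m * x \<in> G k"
      "m < r \<Longrightarrow> x \<in> G k \<Longrightarrow> q m * x \<in> G k"
    and G_raise: "m < r \<Longrightarrow> x \<in> G k \<Longrightarrow> a' m * x \<in> G (Suc k)"
      "m < r \<Longrightarrow> x \<in> G k \<Longrightarrow> \<alpha>' m * x \<in> G (Suc k)"
      "m < r \<Longrightarrow> x \<in> G k \<Longrightarrow> q' m * x \<in> G (Suc k)"
    and vacuum: "m < r \<Longrightarrow> a m - \<alpha> m \<in> N" "m < r \<Longrightarrow> a' m - \<alpha>' m \<in> N"
    and capelli: "m < r \<Longrightarrow> j < r \<Longrightarrow> a m * \<alpha> j = - (\<alpha> j * a m) - q m * \<alpha> j"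
      "m < r \<Longrightarrow> j < r \<Longrightarrow> a' m * \<alpha>' j = - (\<alpha>' j * a' m) - q' m * \<alpha>' j"
    and a_sq: "m < r \<Longrightarrow> a m * a m = a m * q m" and a_q: "m < r \<Longrightarrow> acomm (a m) (q m)"
    and odd: "m < r \<Longrightarrow> j < r \<Longrightarrow> acomm (\<alpha> m) (\<alpha> j)" "m < r \<Longrightarrow> j < r \<Longrightarrow> acomm (\<alpha>' m) (\<alpha>' j)"
      "m < r \<Longrightarrow> j < r \<Longrightarrow> acomm (q m) (\<alpha> j)" "m < r \<Longrightarrow> j < r \<Longrightarrow> acomm (q' m) (\<alpha>' j)"
      "m < r \<Longrightarrow> acomm (q m) (q m)"
    and cross: "m < r \<Longrightarrow> j < r \<Longrightarrow> X \<in> {a m, \<alpha> m, q m} \<Longrightarrow> Y \<in> {a' j, \<alpha>' j, q' j} \<Longrightarrow> acomm X Y"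
begin

lemma q_sq: "m < r \<Longrightarrow> q m * q m = 0"
  by (rule half_acomm_self[OF h_half odd(5)])

text \<open>
  With \<open>A\<close> for \<open>a m + k q m\<close>, the term \<open>h * q m\<close> of the second combination produces \<open>- A q m\<close>, which
  cancels \<open>A A = A q m\<close>. The square of \<open>b\<close> is not cancelled.
\<close>

lemma corrected_pair_product:
  assumes m: "m < r"
    and A: "u + i * w = a m + of_nat k * q m"
    and B: "u - i * w = a' m + of_nat k * q' m + h * q m"
  defines "b \<equiv> a' m + of_nat k * q' m"
  shows "u * w = h * i * ((a m + of_nat k * q m) * b) + h * (h * i) * (b * b)"
proof (rule real_pair_product[OF i_central i_sq h_central h_half])
  let ?A = "a m + of_nat k * q m"
  have qA: "q m * ?A = - (?A * q m)"
    using a_q[OF m] q_sq[OF m] by (simp add: acomm_def algebra_simps mult_of_nat_left)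
  have AA: "?A * ?A = ?A * q m"
    using a_q[OF m] q_sq[OF m] a_sq[OF m] by (simp add: acomm_def algebra_simps mult_of_nat_left)
  have c: "acomm x y" if "x \<in> {a m, q m}" "y \<in> {a' m, q' m}" for x y
    using cross[OF m m, of x y] that by auto
  have bq: "b * q m = - (q m * b)"
    using c by (simp only: b_def flip: acomm_def) (intro acomm_sym[of "q m"] acomm_add acomm_of_nat; simp)
  have bA: "b * ?A = - (?A * b)"
    using c acomm_sym unfolding acomm_def[symmetric] b_def
    by (intro acomm_add acomm_of_nat acomm_sym[OF acomm_add] acomm_sym[OF acomm_of_nat]) blast+
  have h_left: "x * (h * y) = h * (x * y)" for x y
    by (metis h_central mult.assoc)
  have half: "h * x + h * x = x" for x
    by (metis h_half distrib_right mult_1_left)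
  have "(?A + (b + h * q m)) * (?A - (b + h * q m))
      = ?A * ?A - ?A * b - ?A * (h * q m) + b * ?A - b * b - b * (h * q m)
        + h * q m * ?A - h * q m * b - h * q m * (h * q m)"
    by (simp only: distrib_left distrib_right left_diff_distrib right_diff_distrib) simp
  also have "?A * (h * q m) = h * (?A * q m)" by (rule h_left)
  also have "b * (h * q m) = - (h * (q m * b))" by (simp only: h_left bq) simp
  also have "h * q m * ?A = - (h * (?A * q m))" by (simp only: mult.assoc qA) simp
  also have "h * q m * (h * q m) = 0" by (simp only: mult.assoc h_left[of "q m"] q_sq[OF m]) simp
  also have "b * ?A = - (?A * b)" by (rule bA)
  also have "h * q m * b = h * (q m * b)" by (rule mult.assoc)
  also have "?A * ?A = h * (?A * q m) + h * (?A * q m)" by (simp only: AA half)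
  also have "h * (?A * q m) + h * (?A * q m) - ?A * b - h * (?A * q m) + - (?A * b) - b * b
      - - (h * (q m * b)) + - (h * (?A * q m)) - h * (q m * b) - 0 = - (?A * b + ?A * b) - b * b"
    by simp
  finally show "(u + i * w + (u - i * w)) * (u + i * w - (u - i * w)) = - (?A * b + ?A * b) - b * b"
    unfolding A B b_def .
qed

lemma normal_pair_product:
  assumes m: "m < r" and A: "u + i * w = \<alpha> m" and B: "u - i * w = \<alpha>' m"
  shows "u * w = h * i * (\<alpha> m * \<alpha>' m)"
proof -
  have "\<alpha>' m * \<alpha> m = - (\<alpha> m * \<alpha>' m)" "\<alpha> m * \<alpha> m = 0" "\<alpha>' m * \<alpha>' m = 0"
    using cross[OF m m, of "\<alpha> m" "\<alpha>' m"] half_acomm_self[OF h_half odd(1)[OF m m]]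
      half_acomm_self[OF h_half odd(2)[OF m m]] by (simp_all add: acomm_def)
  then have "(\<alpha> m + \<alpha>' m) * (\<alpha> m - \<alpha>' m) = - (\<alpha> m * \<alpha>' m + \<alpha> m * \<alpha>' m) - 0"
    by (simp add: algebra_simps)
  then have "u * w = h * i * (\<alpha> m * \<alpha>' m) + h * (h * i) * 0"
    by (intro real_pair_product[OF i_central i_sq h_central h_half]) (simp only: A B)
  then show ?thesis by simp
qed

lemma G_0: "0 \<in> G k"
  by (rule G_N[OF N_0])

lemma G_of_nat: "x \<in> G k \<Longrightarrow> of_nat l * x \<in> G k"
  by (induction l) (simp_all add: G_0 G_add distrib_right)

lemma G_hi: "x \<in> G k \<Longrightarrow> h * i * x \<in> G k"
  by (simp add: G_h G_i mult.assoc)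

text \<open>
  The induction runs from the last pair of columns to the first. Along with the claim it shows
  that the partial normal product has degree at least the number of its pairs, and that both defect
  operators with that number as shift take it into \<open>N\<close>.
\<close>

theorem corrected_word_eq_normal_word:
  assumes \<Phi>: "\<And>m. m < r \<Longrightarrow> \<Phi> (2 * m) + i * \<Phi> (2 * m + 1) = a m + of_nat (r - Suc m) * q m"
    "\<And>m. m < r \<Longrightarrow> \<Phi> (2 * m) - i * \<Phi> (2 * m + 1) = a' m + of_nat (r - Suc m) * q' m + h * q m"
    and L: "\<And>m. m < r \<Longrightarrow> L (2 * m) + i * L (2 * m + 1) = \<alpha> m"
    "\<And>m. m < r \<Longrightarrow> L (2 * m) - i * L (2 * m + 1) = \<alpha>' m"
  shows "word \<Phi> [0..<2 * r] - word L [0..<2 * r] \<in> G (Suc r)"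
proof -
  let ?W = "\<lambda>m. word L [2 * m..<2 * r]"
  let ?d = "\<lambda>j k. a j - \<alpha> j + of_nat k * q j" and ?d' = "\<lambda>j k. a' j - \<alpha>' j + of_nat k * q' j"
  have hi_left: "y * (h * i * x) = h * i * (y * x)" for x y
    by (metis h_central i_central mult.assoc)
  have "?W m \<in> G (r - m) \<and> (\<forall>j<r. ?d j (r - m) * ?W m \<in> N) \<and> (\<forall>j<r. ?d' j (r - m) * ?W m \<in> N)
      \<and> word \<Phi> [2 * m..<2 * r] - ?W m \<in> G (Suc (r - m))" if "m \<le> r" for m
    using that
  proof (induction rule: inc_induct)
    case base
    show ?case using G_1 G_0 vacuum by simp
  next
    case (step m)
    define k where "k = r - Suc m"
    define \<Lambda> where "\<Lambda> = ?W (Suc m)"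
    define \<Delta> where "\<Delta> = word \<Phi> [2 * Suc m..<2 * r] - \<Lambda>"
    define A where "A = a m + of_nat k * q m"
    define b where "b = a' m + of_nat k * q' m"
    have m: "m < r" and k: "r - m = Suc k"
      using step(2) by (auto simp: k_def)
    have IH: "\<Lambda> \<in> G k" "\<And>j. j < r \<Longrightarrow> ?d j k * \<Lambda> \<in> N" "\<And>j. j < r \<Longrightarrow> ?d' j k * \<Lambda> \<in> N" "\<Delta> \<in> G (Suc k)"
      using step(3) unfolding k_def[symmetric] \<Lambda>_def[symmetric] \<Delta>_def[symmetric] by auto
    have split: "[2 * m..<2 * r] = 2 * m # (2 * m + 1) # [2 * Suc m..<2 * r]"
      using m by (simp add: upt_conv_Cons)
    have W: "?W m = h * i * (\<alpha> m * (\<alpha>' m * \<Lambda>))"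
      using normal_pair_product[OF m L[OF m]] 
      unfolding split word_simps \<Lambda>_def[symmetric] by (simp flip: mult.assoc)
    have "word \<Phi> [2 * m..<2 * r] = (h * i * (A * b) + h * (h * i) * (b * b)) * (\<Delta> + \<Lambda>)"
      using corrected_pair_product[OF m \<Phi>[OF m]]
      unfolding split word_simps \<Delta>_def A_def b_def k_def by (simp flip: mult.assoc)
    then have P: "word \<Phi> [2 * m..<2 * r]
        = h * i * (A * (b * \<Lambda>)) + (h * i * (A * (b * \<Delta>)) + h * (h * i * (b * (b * (\<Delta> + \<Lambda>)))))"
      by (simp add: algebra_simps)
    have b_raise: "b * x \<in> G (Suc l)" if "x \<in> G l" for x l
      using that m by (simp add: b_def distrib_right G_add G_raise G_of_nat mult.assoc)
    have A_keep: "A * x \<in> G l" if "x \<in> G l" for x l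
      using that m by (simp add: A_def distrib_right G_add G_keep G_of_nat mult.assoc)
    \<comment> \<open>Everything except \<open>A b \<Lambda>\<close> has one primed generator too many.\<close>
    have rest: "h * i * (A * (b * \<Delta>)) + h * (h * i * (b * (b * (\<Delta> + \<Lambda>)))) \<in> G (Suc (Suc k))"
      by (intro G_add G_hi G_h A_keep b_raise IH(1) IH(4) G_mono[OF IH(4)])
    have d_step: "?d j (Suc k) * (\<alpha> m * x) = - (\<alpha> m * (?d j k * x))"
      "?d' j l * (\<alpha> m * x) = - (\<alpha> m * (?d' j l * x))"
      "?d' j (Suc k) * (\<alpha>' m * x) = - (\<alpha>' m * (?d' j k * x))"
      "?d j l * (\<alpha>' m * x) = - (\<alpha>' m * (?d j l * x))" if "j < r" for j l x
      using arg_cong[OF capelli_defect_step[OF capelli(1)[OF that m] odd(1)[OF that m] odd(3)[OF that m]], of "\<lambda>y. y * x"]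
        arg_cong[OF capelli_defect_cross[of "a' j" "\<alpha> m" "\<alpha>' j" "q' j" l], of "\<lambda>y. y * x"]
        arg_cong[OF capelli_defect_step[OF capelli(2)[OF that m] odd(2)[OF that m] odd(4)[OF that m]], of "\<lambda>y. y * x"]
        arg_cong[OF capelli_defect_cross[of "a j" "\<alpha>' m" "\<alpha> j" "q j" l], of "\<lambda>y. y * x"]
        cross[OF m that, THEN acomm_sym] cross[OF that m]
      by (simp_all only: mult.assoc minus_mult_left[symmetric] insert_iff simp_thms)
    have N_neg: "- x \<in> N" if "x \<in> N" for x
      using N_mult[OF that, of "-1"] by simp
    have "h * i * (A * (b * \<Lambda>)) - ?W m = h * i * (A * (?d' m k * \<Lambda>) + ?d m k * (\<alpha>' m * \<Lambda>))"
      unfolding W A_def b_def by (simp add: algebra_simps)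
    also have "\<dots> \<in> N"
      unfolding d_step(4)[OF m] by (intro N_mult N_add N_neg IH(2,3) m)
    finally have main: "h * i * (A * (b * \<Lambda>)) - ?W m \<in> N" .
    have "word \<Phi> [2 * m..<2 * r] - ?W m = (h * i * (A * (b * \<Lambda>)) - ?W m) +
        (h * i * (A * (b * \<Delta>)) + h * (h * i * (b * (b * (\<Delta> + \<Lambda>)))))"
      unfolding P by simp
    also have "\<dots> \<in> G (Suc (Suc k))"
      by (rule G_add[OF G_N[OF main] rest])
    finally have 4: "word \<Phi> [2 * m..<2 * r] - ?W m \<in> G (Suc (r - m))"
      by (simp only: k)
    have 1: "?W m \<in> G (r - m)"
      unfolding W k by (intro G_hi G_keep(2) G_raise(2) IH(1) m)
    have "?d j (Suc k) * ?W m \<in> N" if "j < r" for j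
      unfolding W hi_left d_step(1)[OF that] d_step(4)[OF that]
      using IH(2)[OF that] by (auto intro!: N_mult N_neg)
    moreover have "?d' j (Suc k) * ?W m \<in> N" if "j < r" for j
      unfolding W hi_left d_step(2)[OF that] d_step(3)[OF that]
      using IH(3)[OF that] by (auto intro!: N_mult N_neg)
    ultimately show ?case
      using 1 4 unfolding k by blast
  qed
  from this[of 0] show ?thesis by simp
qed

end

section \<open>Capelli relations on Fock space\<close>

text \<open>
  One of the two families. The matrices \<open>z\<close> and \<open>d\<close> have pairwise commuting entries, and the
  commutator of \<open>d j k\<close> with \<open>z i l\<close> is that of Capelli's case, or that of Turnbull's case if
  \<open>symmetric\<close> holds. Only \<open>h + h = 1\<close> is needed of \<open>h\<close>; it serves to divide by two.
\<close>

locale capelli_family =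
  fixes n r :: nat and I J :: "nat list" and \<theta> :: "nat \<Rightarrow> 'a::ring_1 fock_op"
    and z d :: "nat \<Rightarrow> nat \<Rightarrow> 'a" and symmetric :: bool and h :: "'a fock_op"
  assumes half: "h + h = 1"
    and I_less: "a < r \<Longrightarrow> I ! a < n" and J_less: "m < r \<Longrightarrow> J ! m < n"
    and \<theta>_acomm: "acomm (\<theta> a) (\<theta> b)"
    and \<theta>_comm: "comm (\<theta> a) (lmult c)" "comm (\<theta> a) (rmult c)"
    and z_comm: "i < n \<Longrightarrow> k < n \<Longrightarrow> j < n \<Longrightarrow> l < n \<Longrightarrow> comm (z i k) (z j l)"
    and d_comm: "i < n \<Longrightarrow> k < n \<Longrightarrow> j < n \<Longrightarrow> l < n \<Longrightarrow> comm (d i k) (d j l)"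
    and d_z: "i < n \<Longrightarrow> k < n \<Longrightarrow> j < n \<Longrightarrow> l < n \<Longrightarrow>
      d j k * z i l = z i l * d j k + of_bool (j = i \<and> k = l) + of_bool (symmetric \<and> j = l \<and> k = i)"
    and z_sym: "symmetric \<Longrightarrow> i < n \<Longrightarrow> k < n \<Longrightarrow> z i k = z k i"
begin

text \<open>
  Columns of matrices whose rows are those with index in \<open>I\<close>, with the \<open>a\<close>-th row weighted by the generator
  \<open>\<theta> a\<close>: those of \<open>z\<close> and those of \<open>Q\<close>.
\<close>

definition \<zeta> :: "nat \<Rightarrow> 'a fock_op" where
  "\<zeta> k = (\<Sum>a<r. \<theta> a * lmult (z (I ! a) k))"

definition q :: "nat \<Rightarrow> 'a fock_op" where
  "q m = (\<Sum>a<r. \<theta> a * lmult (of_bool (I ! a = J ! m)))"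

text \<open>
  The columns of the minor of \<open>Z D\<^sup>t\<close>, as operators on Fock space, and their normally ordered version, in which the
  derivatives are multiplied from the right.
\<close>

definition column :: "nat \<Rightarrow> 'a fock_op" where
  "column m = (\<Sum>k<n. \<zeta> k * lmult (d (J ! m) k))"

definition normal_column :: "nat \<Rightarrow> 'a fock_op" where
  "normal_column m = (\<Sum>k<n. \<zeta> k * rmult (d (J ! m) k))"

lemma comm_lmult: "comm c c' \<Longrightarrow> comm (lmult c) (lmult c')"
  by (simp add: comm_def flip: lmult_mult)

lemma comm_rmult: "comm c c' \<Longrightarrow> comm (rmult c) (rmult c')"
  by (simp add: comm_def flip: rmult_mult)

lemma comm_of_bool: "comm (of_bool b) x" "comm x (of_bool b)"
  by (simp_all add: comm_def)

lemmas acomm_products = acomm_sum_left acomm_sum_right acomm_mult_left acomm_mult_right comm_mult_right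
  comm_sym[OF \<theta>_comm(1)] comm_sym[OF \<theta>_comm(2)] \<theta>_comm \<theta>_acomm

lemma \<zeta>_acomm: "k < n \<Longrightarrow> l < n \<Longrightarrow> acomm (\<zeta> k) (\<zeta> l)"
  unfolding \<zeta>_def by (intro acomm_products comm_lmult z_comm I_less) simp_all

lemma q_\<zeta>_acomm: "m < r \<Longrightarrow> l < n \<Longrightarrow> acomm (q m) (\<zeta> l)"
  unfolding q_def \<zeta>_def by (intro acomm_products comm_lmult comm_of_bool)

lemma q_acomm: "acomm (q m) (q m')"
  unfolding q_def by (intro acomm_products comm_lmult comm_of_bool)

lemma q_comm: "comm (q m) (rmult c)" "comm (lmult c) (q m)"
  unfolding q_def
  by (auto intro!: comm_sum_left comm_sum_right comm_mult_left comm_mult_right lmult_comm_rmult \<theta>_comm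
      comm_sym[OF \<theta>_comm(1)] comm_lmult comm_of_bool)

lemma \<zeta>_comm_rmult: "comm (\<zeta> k) (rmult c)"
  unfolding \<zeta>_def by (intro comm_sum_left comm_mult_left lmult_comm_rmult \<theta>_comm)

text \<open>
  A symmetric matrix contracted with anticommuting elements vanishes.
\<close>

lemma symmetric_contraction: "symmetric \<Longrightarrow> (\<Sum>a<r. \<zeta> (I ! a) * \<theta> a) = 0"
proof -
  assume sym: symmetric
  let ?t = "\<lambda>a b. \<theta> b * \<theta> a * lmult (z (I ! b) (I ! a))"
  have "\<theta> b * lmult c * \<theta> a = \<theta> b * \<theta> a * lmult c" for a b c
    using \<theta>_comm(1)[of a c] by (simp add: comm_def mult.assoc)
  then have S: "(\<Sum>a<r. \<zeta> (I ! a) * \<theta> a) = (\<Sum>a<r. \<Sum>b<r. ?t a b)"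
    by (simp add: \<zeta>_def sum_distrib_right)
  also have "\<dots> = (\<Sum>a<r. \<Sum>b<r. ?t b a)"
    by (rule sum.swap)
  also have "\<dots> = (\<Sum>a<r. \<Sum>b<r. - ?t a b)"
  proof (intro sum.cong refl)
    fix a b assume "a \<in> {..<r}" "b \<in> {..<r}"
    then have "z (I ! a) (I ! b) = z (I ! b) (I ! a)"
      using z_sym[OF sym] I_less by simp
    then show "?t b a = - ?t a b"
      using \<theta>_acomm[of a b] by (simp add: acomm_def)
  qed
  also have "\<dots> = - (\<Sum>a<r. \<zeta> (I ! a) * \<theta> a)"
    by (simp add: S sum_negf)
  finally have "(\<Sum>a<r. \<zeta> (I ! a) * \<theta> a) + (\<Sum>a<r. \<zeta> (I ! a) * \<theta> a) = 0"
    by (simp add: eq_neg_iff_add_eq_0)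
  then have "h * ((\<Sum>a<r. \<zeta> (I ! a) * \<theta> a) + (\<Sum>a<r. \<zeta> (I ! a) * \<theta> a)) = 0"
    by simp
  then have "(h + h) * (\<Sum>a<r. \<zeta> (I ! a) * \<theta> a) = 0"
    by (simp only: distrib_left distrib_right)
  then show ?thesis
    by (simp add: half)
qed

lemma if_sum: "(\<Sum>x\<in>A. if P then f x else 0) = (if P then sum f A else 0)"
  by simp

text \<open>
  The Capelli relation. Of the commutators of the derivatives in the column with \<open>\<zeta> l\<close>, those from
  \<open>k = l\<close> sum up to \<open>\<zeta> l * q m\<close>, and those which the symmetric case adds vanish by
  \<open>symmetric_contraction\<close>.
\<close>

lemma column_\<zeta>:
  assumes m: "m < r" and l: "l < n"
  shows "column m * \<zeta> l = - (\<zeta> l * column m) + \<zeta> l * q m"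
proof -
  let ?j = "J ! m"
  let ?p = "\<lambda>k. \<Sum>a<r. \<theta> a * lmult (of_bool (k = I ! a))"
  let ?s = "symmetric \<and> ?j = l"
  have d: "lmult (d ?j k) * \<zeta> l = \<zeta> l * lmult (d ?j k) + (if k = l then q m else 0)
      + (if ?s then ?p k else 0)" if k: "k < n" for k
  proof -
    have "lmult c * (\<theta> a * lmult c') = \<theta> a * lmult (c * c')" for a c c'
    proof -
      have "lmult c * \<theta> a * lmult c' = \<theta> a * lmult c * lmult c'"
        using \<theta>_comm(1)[of a c] by (simp add: comm_def)
      then show ?thesis by (simp add: lmult_mult mult.assoc)
    qed
    then have "lmult (d ?j k) * \<zeta> l = (\<Sum>a<r. \<theta> a * lmult (d ?j k * z (I ! a) l))"
      by (simp add: \<zeta>_def sum_distrib_left)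
    also have "\<dots> = (\<Sum>a<r. \<theta> a * lmult (z (I ! a) l) * lmult (d ?j k)
        + (if k = l then \<theta> a * lmult (of_bool (I ! a = ?j)) else 0)
        + (if ?s then \<theta> a * lmult (of_bool (k = I ! a)) else 0))"
    proof (intro sum.cong refl)
      fix a assume "a \<in> {..<r}"
      then have "d ?j k * z (I ! a) l = z (I ! a) l * d ?j k + of_bool (?j = I ! a \<and> k = l)
          + of_bool (symmetric \<and> ?j = l \<and> k = I ! a)"
        by (intro d_z) (use I_less J_less m l k in auto)
      moreover have "\<theta> a * lmult (of_bool (?j = I ! a \<and> k = l))
            = (if k = l then \<theta> a * lmult (of_bool (I ! a = ?j)) else 0)"
        "\<theta> a * lmult (of_bool (symmetric \<and> ?j = l \<and> k = I ! a))
            = (if ?s then \<theta> a * lmult (of_bool (k = I ! a)) else 0)"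
        by (cases "?j = I ! a"; cases "k = l"; simp add: lmult_0) (cases symmetric; cases "?j = l"; simp add: lmult_0)
      ultimately show "\<theta> a * lmult (d ?j k * z (I ! a) l) = \<theta> a * lmult (z (I ! a) l) * lmult (d ?j k)
          + (if k = l then \<theta> a * lmult (of_bool (I ! a = ?j)) else 0)
          + (if ?s then \<theta> a * lmult (of_bool (k = I ! a)) else 0)"
        by (simp only: lmult_add lmult_mult distrib_left mult.assoc)
    qed
    also have "\<dots> = \<zeta> l * lmult (d ?j k) + (if k = l then q m else 0) + (if ?s then ?p k else 0)"
      by (simp only: sum.distrib if_sum \<zeta>_def q_def sum_distrib_right)
    finally show ?thesis .
  qed
  have "(\<Sum>k<n. \<zeta> k * ?p k) = (\<Sum>a<r. \<Sum>k<n. if k = I ! a then \<zeta> k * \<theta> a else 0)"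
    by (subst sum.swap)
      (auto simp: sum_distrib_left mult.assoc lmult_0 lmult_1 intro!: sum.cong)
  also have "\<dots> = (\<Sum>a<r. \<zeta> (I ! a) * \<theta> a)"
    using I_less by (intro sum.cong) auto
  finally have p: "(\<Sum>k<n. \<zeta> k * ?p k) = (\<Sum>a<r. \<zeta> (I ! a) * \<theta> a)" .
  have "column m * \<zeta> l = (\<Sum>k<n. \<zeta> k * (lmult (d ?j k) * \<zeta> l))"
    by (simp add: column_def sum_distrib_right mult.assoc)
  also have "\<dots> = (\<Sum>k<n. - (\<zeta> l * (\<zeta> k * lmult (d ?j k))) + (if k = l then \<zeta> k * q m else 0)
      + (if ?s then \<zeta> k * ?p k else 0))"
  proof (intro sum.cong refl)
    fix k assume "k \<in> {..<n}"
    then have "\<zeta> k * \<zeta> l = - (\<zeta> l * \<zeta> k)" and k: "k < n"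
      using \<zeta>_acomm[of k l] l by (simp_all add: acomm_def)
    then have "\<zeta> k * (\<zeta> l * lmult (d ?j k)) = - (\<zeta> l * (\<zeta> k * lmult (d ?j k)))"
      by (simp flip: mult.assoc)
    then show "\<zeta> k * (lmult (d ?j k) * \<zeta> l) = - (\<zeta> l * (\<zeta> k * lmult (d ?j k)))
        + (if k = l then \<zeta> k * q m else 0) + (if ?s then \<zeta> k * ?p k else 0)"
      unfolding d[OF k] distrib_left by simp
  qed
  also have "\<dots> = - (\<zeta> l * column m) + \<zeta> l * q m + (if ?s then \<Sum>k<n. \<zeta> k * ?p k else 0)"
    using l unfolding sum.distrib if_sum by (simp add: column_def sum_distrib_left sum_negf)
  also have "\<dots> = - (\<zeta> l * column m) + \<zeta> l * q m"
    unfolding p using symmetric_contraction by simp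
  finally show ?thesis .
qed

lemma q_column_acomm: "m < r \<Longrightarrow> acomm (q m) (column m')"
  unfolding column_def
  by (intro acomm_sum_right acomm_mult_right q_\<zeta>_acomm comm_sym[OF q_comm(2)]) auto

lemma q_normal_column_acomm: "m < r \<Longrightarrow> acomm (q m) (normal_column m')"
  unfolding normal_column_def
  by (intro acomm_sum_right acomm_mult_right q_\<zeta>_acomm q_comm(1)) auto

lemma normal_column_acomm: "m < r \<Longrightarrow> m' < r \<Longrightarrow> acomm (normal_column m) (normal_column m')"
  unfolding normal_column_def
  by (intro acomm_sum_right acomm_sum_left acomm_mult_right acomm_mult_left \<zeta>_acomm
      comm_mult_right comm_rmult d_comm J_less \<zeta>_comm_rmult comm_sym[OF \<zeta>_comm_rmult])
    (auto simp: J_less)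

lemma column_normal_column:
  assumes "m < r" "j < r"
  shows "column m * normal_column j = - (normal_column j * column m) - q m * normal_column j"
proof -
  have c: "comm (column m) (rmult c)" for c
    unfolding column_def by (intro comm_sum_left comm_mult_left \<zeta>_comm_rmult lmult_comm_rmult)
  have "column m * normal_column j = (\<Sum>l<n. column m * \<zeta> l * rmult (d (J ! j) l))"
    by (simp add: normal_column_def sum_distrib_left mult.assoc)
  also have "\<dots> = (\<Sum>l<n. - (\<zeta> l * rmult (d (J ! j) l) * column m) + \<zeta> l * rmult (d (J ! j) l) * q m)"
    using c q_comm(1) by (intro sum.cong refl) (simp add: column_\<zeta>[OF assms(1)] comm_def left_diff_distrib right_diff_distrib mult.assoc)
  also have "\<dots> = - (normal_column j * column m) + normal_column j * q m"
    unfolding sum.distrib by (simp add: normal_column_def sum_distrib_right sum_negf)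
  also have "normal_column j * q m = - (q m * normal_column j)"
    using q_normal_column_acomm[OF assms(1), of j] by (simp add: acomm_def)
  finally show ?thesis by simp
qed

lemma column_sq:
  assumes m: "m < r"
  shows "column m * column m = column m * q m"
proof -
  let ?d = "\<lambda>k. lmult (d (J ! m) k)"
  let ?T = "\<Sum>l<n. \<Sum>k<n. \<zeta> l * \<zeta> k * (?d k * ?d l)"
  have "?T = (\<Sum>l<n. \<Sum>k<n. \<zeta> k * \<zeta> l * (?d l * ?d k))"
    by (rule sum.swap)
  also have "\<dots> = - ?T"
    unfolding sum_negf[symmetric]
  proof (intro sum.cong refl)
    fix k l assume "k \<in> {..<n}" "l \<in> {..<n}"
    then have "\<zeta> k * \<zeta> l = - (\<zeta> l * \<zeta> k)" "?d l * ?d k = ?d k * ?d l"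
      using \<zeta>_acomm[of k l] comm_lmult[OF d_comm, of "J ! m" l "J ! m" k] J_less[OF m]
      by (simp_all add: acomm_def comm_def)
    then show "\<zeta> k * \<zeta> l * (?d l * ?d k) = - (\<zeta> l * \<zeta> k * (?d k * ?d l))"
      by simp
  qed
  finally have "h * (?T + ?T) = 0"
    by (simp add: eq_neg_iff_add_eq_0)
  then have "(h + h) * ?T = 0"
    by (simp only: distrib_left distrib_right)
  then have T: "?T = 0"
    by (simp add: half)
  have "column m * column m = (\<Sum>l<n. column m * \<zeta> l * ?d l)"
    by (subst (2) column_def) (simp add: sum_distrib_left mult.assoc)
  also have "\<dots> = (\<Sum>l<n. - (\<zeta> l * column m * ?d l) + \<zeta> l * ?d l * q m)"
    using q_comm(2) by (intro sum.cong refl) (simp add: column_\<zeta>[OF m] comm_def left_diff_distrib right_diff_distrib mult.assoc)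
  also have "\<dots> = - (\<Sum>l<n. \<zeta> l * column m * ?d l) + column m * q m"
    unfolding sum.distrib sum_negf by (subst (3) column_def) (simp add: sum_distrib_right)
  also have "(\<Sum>l<n. \<zeta> l * column m * ?d l) = ?T"
    by (simp add: column_def sum_distrib_left sum_distrib_right mult.assoc)
  finally show ?thesis
    by (simp add: T)
qed

lemma column_minus_normal_column: "column m - normal_column m \<in> ann"
proof -
  have "column m - normal_column m = (\<Sum>k<n. \<zeta> k * (lmult (d (J ! m) k) - rmult (d (J ! m) k)))"
    by (simp add: column_def normal_column_def right_diff_distrib sum_subtractf)
  moreover have "sum f A \<in> ann" if "\<And>k. f k \<in> ann" for f :: "nat \<Rightarrow> 'a fock_op" and A
    by (induction A rule: infinite_finite_induct) (simp_all add: ann_0 ann_add that)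
  ultimately show ?thesis
    by (simp add: ann_mult lmult_rmult_ann)
qed

lemma column_expand: "column m = (\<Sum>a<r. \<theta> a * lmult (\<Sum>k<n. z (I ! a) k * d (J ! m) k))"
  unfolding column_def \<zeta>_def sum_distrib_right
  by (subst sum.swap) (simp add: lmult_sum lmult_mult sum_distrib_left mult.assoc)

text \<open>
  Stated for two degrees at once, since the generators \<open>\<theta>\<close> preserve the odd degree for one family and
  raise it for the other.
\<close>

lemma degree_shift:
  assumes "\<And>a X. X \<in> odd_degree_ge k \<Longrightarrow> \<theta> a * X \<in> odd_degree_ge l" and X: "X \<in> odd_degree_ge k"
  shows "column m * X \<in> odd_degree_ge l" "normal_column m * X \<in> odd_degree_ge l" "q m * X \<in> odd_degree_ge l"
proof -
  have sum: "sum f A \<in> odd_degree_ge l" if "\<And>k. f k \<in> odd_degree_ge l" for f :: "nat \<Rightarrow> 'a fock_op" and A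
    by (induction A rule: infinite_finite_induct)
      (simp_all add: odd_degree_ge_add that odd_degree_ge_ann ann_0)
  have "\<zeta> j * Y \<in> odd_degree_ge l" if "Y \<in> odd_degree_ge k" for j Y
    using that unfolding \<zeta>_def by (simp add: sum_distrib_right mult.assoc sum assms(1) odd_degree_ge_lmult)
  then show "column m * X \<in> odd_degree_ge l" "normal_column m * X \<in> odd_degree_ge l"
    using X unfolding column_def normal_column_def
    by (simp_all add: sum_distrib_right mult.assoc sum odd_degree_ge_lmult odd_degree_ge_rmult)
  show "q m * X \<in> odd_degree_ge l"
    using X unfolding q_def by (simp add: sum_distrib_right mult.assoc sum assms(1) odd_degree_ge_lmult)
qed

end

section \<open>Commutation relations of the matrix entries\<close>

lemma const_op_central: "const_op c * X = X * const_op c"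
proof transfer
  fix c :: complex and f :: "'a cpoly \<Rightarrow> 'a cpoly"
  assume "f \<in> diff_ops"
  then have "pconst c * f p = f (pconst c * p)" for p
  proof (induction arbitrary: p rule: diff_ops.induct)
    case (deriv v)
    then show ?case by (simp add: partial_deriv_mult partial_deriv_pconst)
  next
    case (mult q)
    show ?case by (rule mult.left_commute)
  qed (simp_all add: distrib_left)
  then show "(\<lambda>p. pconst c * f p) = (\<lambda>p. f (pconst c * p))"
    by (rule ext)
qed

lemma partial_deriv_commute: "partial_deriv v (partial_deriv w p) = partial_deriv w (partial_deriv v p)"
proof (cases "v = w")
  case False
  show ?thesis
  proof (induction p rule: cpoly_add_induct)
    case (single m c)
    have "m - Poly_Mapping.single w 1 - Poly_Mapping.single v 1
        = m - Poly_Mapping.single v 1 - Poly_Mapping.single w (1::nat)"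
      by (intro poly_mapping_eqI) (simp add: lookup_minus)
    then show ?case
      using False by (simp add: partial_deriv_single lookup_minus lookup_single mult.left_commute)
  qed (simp_all add: partial_deriv_add)
qed simp

lemma deriv_op_comm: "comm (deriv_op v) (deriv_op w)"
  unfolding comm_def by transfer (rule ext, rule partial_deriv_commute)

lemma var_op_comm: "comm (var_op v) (var_op w)"
  unfolding comm_def by transfer (simp add: mult.left_commute)

lemma deriv_op_var_op: "deriv_op v * var_op w = var_op w * deriv_op v + of_bool (v = w)"
proof (cases "v = w")
  case True
  then show ?thesis
    by simp (transfer, simp add: fun_eq_iff partial_deriv_mult partial_deriv_pvar add.commute)
next
  case False
  then show ?thesis
    by simp (transfer, simp add: fun_eq_iff partial_deriv_mult partial_deriv_pvar)
qed

lemma const_op_comm: "comm (const_op c) X" "comm X (const_op c)"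
  by (simp_all add: comm_def const_op_central)

text \<open>
  \<open>h (X - i Y)\<close> is a Wirtinger derivative: it differentiates \<open>x + i y\<close> to \<open>e\<close> and \<open>x - i y\<close> to zero.
  The two contributions to the former add up to \<open>e + e\<close>, and \<open>h\<close> halves them.
\<close>

lemma complex_derivation:
  fixes i h :: "'a::ring_1"
  assumes i: "\<And>x. i * x = x * i" "i * i = -1" and h: "\<And>x. h * x = x * h" "h + h = 1"
    and "X * x = x * X + e" "Y * y = y * Y + e" "X * y = y * X" "Y * x = x * Y"
  shows "h * (X - i * Y) * (x + i * y) = (x + i * y) * (h * (X - i * Y)) + e"
    and "h * (X - i * Y) * (x - i * y) = (x - i * y) * (h * (X - i * Y))"
proof -
  have c: "w * (i * v) = i * (w * v)" for w v
    using i(1)[of w] by (simp flip: mult.assoc)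
  have ii: "i * (i * w) = - w" for w
    using i(2) by (simp flip: mult.assoc)
  have "(X - i * Y) * (x + i * y) = (x + i * y) * (X - i * Y) + (e + e)"
    using assms(5-8) by (simp add: algebra_simps c[of X] c[of Y] c[of x] c[of y] ii)
  then have "h * ((X - i * Y) * (x + i * y)) = h * ((x + i * y) * (X - i * Y)) + h * (e + e)"
    by (simp only: distrib_left)
  moreover have "h * (e + e) = e"
    by (metis h(2) distrib_left distrib_right mult_1_left)
  ultimately show "h * (X - i * Y) * (x + i * y) = (x + i * y) * (h * (X - i * Y)) + e"
    using h(1)[of "x + i * y"] by (simp add: mult.assoc[symmetric])
  have "(X - i * Y) * (x - i * y) = (x - i * y) * (X - i * Y)"
    using assms(5-8) by (simp add: algebra_simps c[of X] c[of Y] c[of x] c[of y] ii)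
  then have "h * ((X - i * Y) * (x - i * y)) = h * ((x - i * y) * (X - i * Y))"
    by simp
  then show "h * (X - i * Y) * (x - i * y) = (x - i * y) * (h * (X - i * Y))"
    using h(1)[of "x - i * y"] by (simp add: mult.assoc[symmetric])
qed

lemma const_op_i_sq: "const_op \<i> * const_op \<i> = -1"
  by (simp add: const_op_mult const_op_neg const_op_1)

lemma const_op_half_add: "const_op (1 / 2) + const_op (1 / 2) = 1"
  by (simp add: const_op_add const_op_1)

lemma cnj_op_1: "cnj_op 1 = 1"
  by (metis cnj_op_const_op complex_cnj_one const_op_1)

lemma cnj_op_0: "cnj_op 0 = 0"
  by (metis cnj_op_const_op complex_cnj_zero const_op_0)

lemma cnj_op_of_bool: "cnj_op (of_bool b) = of_bool b"
  by (simp add: cnj_op_0 cnj_op_1)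

lemma cnj_op_minus: "cnj_op (- x) = - cnj_op x"
  using cnj_op_diff[of 0 x] by (simp add: cnj_op_0)

lemma cnj_op_sum: "cnj_op (sum f A) = (\<Sum>k\<in>A. cnj_op (f k))"
  by (induction A rule: infinite_finite_induct) (simp_all add: cnj_op_add cnj_op_0)

lemma cnj_z_op: "cnj_op (z_op a b) = var_op (VX a b) - const_op \<i> * var_op (VY a b)"
  by (simp add: z_op_def cnj_op_add cnj_op_mult cnj_op_const_op cnj_op_var_op const_op_neg)

lemma cnj_dz_op: "cnj_op (dz_op a b) = const_op (1 / 2) * (deriv_op (VX a b) + const_op \<i> * deriv_op (VY a b))"
  by (simp add: dz_op_def cnj_op_diff cnj_op_mult cnj_op_const_op cnj_op_deriv_op const_op_neg)

lemma z_op_comm: "comm (z_op a b) (z_op c d)" "comm (z_op a b) (cnj_op (z_op c d))"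
  unfolding cnj_z_op unfolding z_op_def
  by (intro comm_add_left comm_add_right comm_diff_right comm_mult_left comm_mult_right
      const_op_comm var_op_comm)+

lemma dz_op_comm: "comm (dz_op a b) (dz_op c d)" "comm (dz_op a b) (cnj_op (dz_op c d))"
  unfolding cnj_dz_op unfolding dz_op_def
  by (intro comm_add_right comm_diff_right comm_diff_left comm_mult_left comm_mult_right
      const_op_comm deriv_op_comm)+

lemma dz_op_z_op:
  "dz_op a b * z_op c d = z_op c d * dz_op a b + of_bool (a = c \<and> b = d)"
  "comm (dz_op a b) (cnj_op (z_op c d))"
  unfolding cnj_z_op unfolding comm_def dz_op_def z_op_def
  by (rule complex_derivation[OF const_op_central const_op_i_sq const_op_central const_op_half_add,
        where e = "of_bool (a = c \<and> b = d)"]; simp add: deriv_op_var_op)+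

section \<open>Entries of real forms and of the correction term\<close>

lemma real_form_index:
  assumes "a < dim_row M" "b < dim_col M"
  shows "real_form M $$ (2 * a, 2 * b) = Re_op (M $$ (a, b))"
    "real_form M $$ (2 * a, Suc (2 * b)) = Im_op (M $$ (a, b))"
    "real_form M $$ (Suc (2 * a), 2 * b) = - Im_op (M $$ (a, b))"
    "real_form M $$ (Suc (2 * a), Suc (2 * b)) = Re_op (M $$ (a, b))"
  using assms by (simp_all add: real_form_def Let_def)

lemma length_real_index: "length (real_index I) = 2 * length I"
  by (induction I) (simp_all add: real_index_def)

lemma real_index_nth:
  "a < length I \<Longrightarrow> real_index I ! (2 * a) = 2 * I ! a"
  "a < length I \<Longrightarrow> real_index I ! Suc (2 * a) = Suc (2 * I ! a)"
proof (induction I arbitrary: a)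
  case (Cons x I)
  { case 1 then show ?case using Cons.IH(1) by (cases a) (auto simp: real_index_def) }
  { case 2 then show ?case using Cons.IH(2) by (cases a) (auto simp: real_index_def) }
qed simp_all

lemma real_index_nth_less:
  assumes "set I \<subseteq> {0..<n}" "k < 2 * length I"
  shows "real_index I ! k < 2 * n"
proof -
  have "set (real_index I) \<subseteq> {0..<2 * n}"
    using assms(1) by (auto simp: real_index_def)
  moreover have "real_index I ! k \<in> set (real_index I)"
    using assms(2) by (simp add: length_real_index)
  ultimately show ?thesis by auto
qed

lemma sum_pairs: "(\<Sum>p<2 * r. f p) = (\<Sum>a<r. f (2 * a) + f (Suc (2 * a)))"
  for f :: "nat \<Rightarrow> 'a::comm_monoid_add"
  by (induction r) (simp_all add: add.assoc)

lemma dim_diag_block_mat_2: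
  assumes "\<And>A. A \<in> set As \<Longrightarrow> A \<in> carrier_mat 2 2"
  shows "dim_row (diag_block_mat As) = 2 * length As" "dim_col (diag_block_mat As) = 2 * length As"
proof -
  have "sum_list (map dim_row As) = 2 * length As \<and> sum_list (map dim_col As) = 2 * length As"
    using assms by (induction As) auto
  then show "dim_row (diag_block_mat As) = 2 * length As" "dim_col (diag_block_mat As) = 2 * length As"
    by (simp_all add: dim_diag_block_mat)
qed

lemma diag_block_mat_index:
  assumes "\<And>A. A \<in> set As \<Longrightarrow> A \<in> carrier_mat 2 2" "a < length As" "b < length As" "u < 2" "v < 2"
  shows "diag_block_mat As $$ (2 * a + u, 2 * b + v) = (if a = b then As ! a $$ (u, v) else 0)"
  using assms(1-3)
proof (induction As arbitrary: a b)
  case (Cons A As)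
  have A: "dim_row A = 2" "dim_col A = 2"
    using Cons.prems(1) by auto
  have B: "dim_row (diag_block_mat As) = 2 * length As" "dim_col (diag_block_mat As) = 2 * length As"
    using Cons.prems(1) by (auto intro!: dim_diag_block_mat_2)
  show ?case
    using Cons.prems Cons.IH[of "a - 1" "b - 1"] assms(4,5)
    by (cases a; cases b) (auto simp: Let_def A B)
qed simp

lemma T_block_carrier: "T_block s r k \<in> carrier_mat 2 2"
  by (intro carrier_matI) (simp_all add: T_block_def mat_of_rows_list_def)

lemma T_mat_index:
  assumes "a < r" "m < r" "u < 2" "v < 2"
  shows "T_mat s r $$ (2 * a + u, 2 * m + v)
    = (if a = m then const_op (T_block s r (Suc m) $$ (u, v)) else 0)"
proof -
  let ?B = "diag_block_mat (map (T_block s r) [1..<r + 1])"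
  have B: "dim_row ?B = 2 * r" "dim_col ?B = 2 * r"
    by (subst dim_diag_block_mat_2; auto simp: T_block_carrier)+
  have "?B $$ (2 * a + u, 2 * m + v) = (if a = m then map (T_block s r) [1..<r + 1] ! a $$ (u, v) else 0)"
    by (rule diag_block_mat_index) (use assms T_block_carrier in auto)
  moreover have "T_mat s r $$ (2 * a + u, 2 * m + v) = const_op (?B $$ (2 * a + u, 2 * m + v))"
    unfolding T_mat_def by (rule index_map_mat(1)) (simp_all only: B, use assms in simp_all)
  moreover have "map (T_block s r) [1..<r + 1] ! a = T_block s r (Suc a)"
    using assms(1) by (simp del: upt_Suc)
  ultimately show ?thesis
    by (cases "a = m") (auto simp: const_op_0 simp del: upt_Suc)
qed

lemma T_mat_carrier: "T_mat s r \<in> carrier_mat (2 * r) (2 * r)"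
  by (intro carrier_matI; simp only: T_mat_def index_map_mat; subst dim_diag_block_mat_2;
      auto simp: T_block_carrier)

lemma Re_Im_of_bool: "Re_op (of_bool b) = of_bool b" "Im_op (of_bool b) = 0"
  using Re_op_Im_op_unique[of "of_bool b" 0 "of_bool b"] by (auto simp: cnj_op_0 cnj_op_1)

text \<open>
  The entries of the correction term, which are constants.
\<close>

lemma Q_T_index:
  assumes "length I = r" "length J = r" "a < r" "m < r" "u < 2" "v < 2"
  shows "(real_form (Q_mat I J) * T_mat s r) $$ (2 * a + u, 2 * m + v)
    = of_bool (I ! a = J ! m) * const_op (T_block s r (Suc m) $$ (u, v))"
proof -
  let ?R = "real_form (Q_mat I J)"
  have u: "u = 0 \<or> u = 1" using assms(5) by auto
  have Q: "?R $$ (2 * a + u, 2 * b + w) = of_bool (u = w) * of_bool (I ! a = J ! b)" if "b < r" "w < 2" for b w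
  proof -
    have "w = 0 \<or> w = 1" using that by auto
    moreover have "Q_mat I J $$ (a, b) = of_bool (I ! a = J ! b)"
      using assms that by (simp add: Q_mat_def)
    ultimately show ?thesis
      using real_form_index[of a "Q_mat I J" b] assms that u
      by (auto simp: Q_mat_def Re_Im_of_bool)
  qed
  have "(?R * T_mat s r) $$ (2 * a + u, 2 * m + v)
      = (\<Sum>t<2 * r. ?R $$ (2 * a + u, t) * T_mat s r $$ (t, 2 * m + v))"
    using assms T_mat_carrier[of s r]
    by (auto simp: scalar_prod_def real_form_def Q_mat_def lessThan_atLeast0 intro!: sum.cong)
  also have "\<dots> = (\<Sum>b<r. ?R $$ (2 * a + u, 2 * b + 0) * T_mat s r $$ (2 * b + 0, 2 * m + v)
      + ?R $$ (2 * a + u, 2 * b + 1) * T_mat s r $$ (2 * b + 1, 2 * m + v))"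
    by (simp add: sum_pairs)
  also have "\<dots> = (\<Sum>b<r. if b = m then of_bool (I ! a = J ! m) * const_op (T_block s r (Suc m) $$ (u, v)) else 0)"
  proof (intro sum.cong refl)
    fix b assume "b \<in> {..<r}"
    then have b: "b < r" by simp
    have zero_one: "(0::nat) < 2" "(1::nat) < 2" by simp_all
    show "?R $$ (2 * a + u, 2 * b + 0) * T_mat s r $$ (2 * b + 0, 2 * m + v)
      + ?R $$ (2 * a + u, 2 * b + 1) * T_mat s r $$ (2 * b + 1, 2 * m + v)
      = (if b = m then of_bool (I ! a = J ! m) * const_op (T_block s r (Suc m) $$ (u, v)) else 0)"
      unfolding Q[OF b zero_one(1)] Q[OF b zero_one(2)] T_mat_index[OF b assms(4) zero_one(1) assms(6)]
        T_mat_index[OF b assms(4) zero_one(2) assms(6)]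
      using u by auto
  qed
  also have "\<dots> = of_bool (I ! a = J ! m) * const_op (T_block s r (Suc m) $$ (u, v))"
    using assms(4) by simp
  finally show ?thesis .
qed

lemma of_int_sign_hom:
  assumes "\<And>x. f (- x) = - f x"
  shows "f (of_int (sign \<sigma>) * x) = of_int (sign \<sigma>) * f x"
  by (simp add: sign_def assms)

text \<open>
  The hypothesis on products holds for ring homomorphisms, and for antihomomorphisms if the entries
  commute; both are used.
\<close>

lemma col_det_map:
  fixes f :: "'a::ring_1 \<Rightarrow> 'b::ring_1"
  assumes add: "\<And>x y. f (x + y) = f x + f y"
    and prod: "\<And>\<sigma>. \<sigma> permutes {0..<N} \<Longrightarrow>
      f (prod_list (map (\<lambda>k. M (\<sigma> k) k) [0..<N])) = prod_list (map (\<lambda>k. f (M (\<sigma> k) k)) [0..<N])"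
  shows "col_det (mat N N (\<lambda>(a, k). f (M a k))) = f (col_det (mat N N (\<lambda>(a, k). M a k)))"
proof -
  have f0: "f 0 = 0" using add[of 0 0] by simp
  have fm: "f (- x) = - f x" for x
    using add[of x "- x"] by (simp add: f0 eq_neg_iff_add_eq_0 add.commute)
  have fs: "f (sum g A) = (\<Sum>k\<in>A. f (g k))" for g :: "'c \<Rightarrow> 'a" and A
    by (induction A rule: infinite_finite_induct) (simp_all add: f0 add)
  have in_range: "\<sigma> k < N" if "\<sigma> permutes {0..<N}" "k < N" for \<sigma> k
    using permutes_in_image[OF that(1), of k] that(2) by simp
  show ?thesis
    unfolding col_det_def fs of_int_sign_hom[of f, OF fm] dim_row_mat
  proof (intro sum.cong refl arg_cong2[where f = "(*)"])
    fix \<sigma> assume "\<sigma> \<in> {\<sigma>. \<sigma> permutes {0..<N}}"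
    then have \<sigma>: "\<sigma> permutes {0..<N}" by simp
    then have "map (\<lambda>k. mat N N (\<lambda>(a, k). f (M a k)) $$ (\<sigma> k, k)) [0..<N] = map (\<lambda>k. f (M (\<sigma> k) k)) [0..<N]"
      "map (\<lambda>k. mat N N (\<lambda>(a, k). M a k) $$ (\<sigma> k, k)) [0..<N] = map (\<lambda>k. M (\<sigma> k) k) [0..<N]"
      using in_range by auto
    then show "prod_list (map (\<lambda>k. mat N N (\<lambda>(a, k). f (M a k)) $$ (\<sigma> k, k)) [0..<N])
      = f (prod_list (map (\<lambda>k. mat N N (\<lambda>(a, k). M a k) $$ (\<sigma> k, k)) [0..<N]))"
      by (simp only: prod[OF \<sigma>])
  qed
qed

section \<open>Real and complex generators\<close>

text \<open>
  A complex constant as an operator on Fock space.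
\<close>

definition scal :: "complex \<Rightarrow> 'v diffop fock_op" where
  "scal c = lmult (const_op c)"

lemma scal_central: "scal c * X = X * scal c"
  unfolding scal_def by (rule lmult_central[OF const_op_central])

lemma scal_add: "scal (c + d) = scal c + scal d"
  by (simp add: scal_def lmult_add flip: const_op_add)

lemma scal_mult: "scal (c * d) = scal c * scal d"
  by (simp add: scal_def lmult_mult flip: const_op_mult)

lemma scal_1: "scal 1 = 1"
  by (simp add: scal_def const_op_1 lmult_1)

lemma scal_uminus: "scal (- c) = - scal c"
  by (simp add: scal_def const_op_neg lmult_minus)

lemma scal_diff: "scal (c - d) = scal c - scal d"
  using scal_add[of c "- d"] by (simp add: scal_uminus)

lemma scal_of_nat: "scal (of_nat k) = of_nat k"
  using scal_add[of 0 0] by (induction k) (simp_all add: scal_add scal_1)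

lemma scal_comm: "comm (scal c) X" "comm X (scal c)"
  by (simp_all add: comm_def scal_central)

lemma scal_rmult: "scal c = rmult (const_op c)"
  unfolding scal_def by (rule lmult_eq_rmult[OF const_op_central])

lemma scal_i_sq: "scal \<i> * scal \<i> = -1"
  by (simp add: scal_uminus scal_1 flip: scal_mult)

lemma scal_half_add: "scal (1 / 2) + scal (1 / 2) = 1"
  by (simp add: scal_1 flip: scal_add)

text \<open>
  The generators that belong to the rows of a real form, expressed through the complex
  generators \<open>\<theta>\<^sub>a = gen (2 * a)\<close> and \<open>\<theta>'\<^sub>a = gen (2 * a + 1)\<close>; \<open>psi_gen\<close> gives the converse. Taking the
  latter as the basis of Fock space makes the degree in \<open>\<theta>'\<close> visible in the index sets.
\<close>

definition psi :: "nat \<Rightarrow> 'v diffop fock_op" where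
  "psi p = (if even p then (gen p + gen (Suc p)) * scal (1 / 2)
    else (gen p - gen (p - 1)) * (scal (1 / 2) * scal \<i>))"

lemma psi_gen:
  "psi (2 * a) + scal \<i> * psi (Suc (2 * a)) = (gen (2 * a) :: 'v diffop fock_op)"
  "psi (2 * a) - scal \<i> * psi (Suc (2 * a)) = (gen (Suc (2 * a)) :: 'v diffop fock_op)"
proof -
  have "scal \<i> * psi (Suc (2 * a)) = (psi (Suc (2 * a)) * scal \<i> :: 'v diffop fock_op)"
    by (rule scal_central)
  also have "\<dots> = (gen (Suc (2 * a)) - gen (2 * a)) * (scal (1 / 2) * (scal \<i> * scal \<i>))"
    by (simp add: psi_def mult.assoc)
  finally have i: "scal \<i> * psi (Suc (2 * a)) = (gen (2 * a) - gen (Suc (2 * a))) * (scal (1 / 2) :: 'v diffop fock_op)"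
    by (simp add: scal_i_sq left_diff_distrib)
  have half: "x * scal (1 / 2) + x * scal (1 / 2) = x" for x :: "'v diffop fock_op"
    by (metis scal_half_add distrib_left mult_1_right)
  show "psi (2 * a) + scal \<i> * psi (Suc (2 * a)) = (gen (2 * a) :: 'v diffop fock_op)"
    "psi (2 * a) - scal \<i> * psi (Suc (2 * a)) = (gen (Suc (2 * a)) :: 'v diffop fock_op)"
    unfolding i using half
    by (simp_all add: psi_def distrib_right left_diff_distrib)
qed

lemma psi_acomm: "acomm (psi p) (psi p')"
  unfolding psi_def if_distrib[of "\<lambda>x. acomm x _"] if_distrib[of "acomm _"]
  by (auto intro!: acomm_mult_left acomm_mult_right acomm_add_left acomm_add acomm_diff_left
      acomm_diff_right gen_acomm comm_mult_left comm_mult_right scal_comm)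

lemma psi_comm: "comm (psi p) (lmult c)" "comm (psi p) (rmult c)"
  unfolding psi_def
  by (auto intro!: comm_mult_left comm_add_left comm_diff_left gen_comm_lmult gen_comm_rmult scal_comm)

lemma psi_sq: "psi p * psi p = 0"
  by (rule half_acomm_self[OF scal_half_add psi_acomm])

text \<open>
  The top monomial in the real generators is a power of \<open>\<i> / 2\<close> times that in the complex ones.
\<close>

lemma app_word_psi: "app (word psi [0..<2 * r] :: 'v diffop fock_op) vac {0..<2 * r} = const_op (\<i> / 2) ^ r"
proof -
  let ?k = "scal (1 / 2) * scal \<i>"
  have pair: "psi (2 * a) * (psi (Suc (2 * a)) :: 'v diffop fock_op) = ?k * (gen (2 * a) * gen (Suc (2 * a)))" for a
  proof -
    have "(gen (2 * a) + gen (Suc (2 * a))) * (gen (2 * a) - gen (Suc (2 * a)))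
        = - (gen (2 * a) * gen (Suc (2 * a)) + gen (2 * a) * gen (Suc (2 * a))) - (0 :: 'v diffop fock_op)"
      using gen_acomm[of "Suc (2 * a)" "2 * a"]
      by (simp add: distrib_right right_diff_distrib gen_sq acomm_def)
    then have "psi (2 * a) * (psi (Suc (2 * a)) :: 'v diffop fock_op) = ?k * (gen (2 * a) * gen (Suc (2 * a)))
        + scal (1 / 2) * ?k * (0 :: 'v diffop fock_op)"
      by (intro real_pair_product[OF scal_central scal_i_sq scal_central scal_half_add])
        (simp only: psi_gen)
    then show ?thesis by simp
  qed
  have "(word psi [2 * m..<2 * r] :: 'v diffop fock_op) = ?k ^ (r - m) * word gen [2 * m..<2 * r]" if "m \<le> r" for m
    using that
  proof (induction rule: inc_induct)
    case (step m)
    have split: "[2 * m..<2 * r] = 2 * m # Suc (2 * m) # [2 * Suc m..<2 * r]"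
      using step(2) by (simp add: upt_conv_Cons)
    have k: "r - m = Suc (r - Suc m)"
      using step(2) by simp
    have c: "x * ?k ^ l = ?k ^ l * x" for x :: "'v diffop fock_op" and l
      by (metis scal_central scal_mult power_commuting_commutes)
    have "(word psi [2 * m..<2 * r] :: 'v diffop fock_op) = psi (2 * m) * psi (Suc (2 * m)) * (?k ^ (r - Suc m) * word gen [2 * Suc m..<2 * r])"
      unfolding split word_simps step(3) by (simp only: mult.assoc)
    also have "\<dots> = ?k * (gen (2 * m) * gen (Suc (2 * m)) * ?k ^ (r - Suc m)) * word gen [2 * Suc m..<2 * r]"
      unfolding pair by (simp only: mult.assoc)
    also have "\<dots> = ?k ^ (r - m) * word gen [2 * m..<2 * r]"
      unfolding c[of "gen (2 * m) * gen (Suc (2 * m))"] split word_simps k power_Suc by (simp only: mult.assoc)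
    finally show ?case .
  qed simp
  from this[of 0] have "word psi [0..<2 * r] = ?k ^ r * (word gen [0..<2 * r] :: 'v diffop fock_op)"
    by simp
  moreover have "app (?k ^ l * X) u S = const_op (\<i> / 2) ^ l * app X u S" for l u S and X :: "'v diffop fock_op"
  proof (induction l)
    case (Suc l)
    have "app (?k ^ Suc l * X) u S = const_op (1 / 2) * (const_op \<i> * app (?k ^ l * X) u S)"
      by (simp add: scal_def app_simps mult.assoc)
    also have "\<dots> = const_op (\<i> / 2) * app (?k ^ l * X) u S"
      by (simp add: const_op_mult flip: mult.assoc)
    finally show ?case
      by (simp only: Suc power_Suc mult.assoc)
  qed (simp add: app_simps)
  ultimately show ?thesis
    using app_word_gen[of 0 "2 * r", where 'a = "'v diffop"] by simp
qed

lemma complex_combination: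
  fixes i :: "'a::ring_1"
  assumes "\<And>x. i * x = x * i" "i * i = -1"
  shows "u * R + v * (- M) + i * (u * M + v * R) = (u + i * v) * (R + i * M)"
    "u * R + v * (- M) - i * (u * M + v * R) = (u - i * v) * (R - i * M)"
proof -
  have c: "u * (i * x) = i * (u * x)" "v * (i * x) = i * (v * x)" "i * (i * x) = - x" for x
    using assms(1)[of u] assms(1)[of v] assms(2) by (simp_all flip: mult.assoc)
  show "u * R + v * (- M) + i * (u * M + v * R) = (u + i * v) * (R + i * M)"
    "u * R + v * (- M) - i * (u * M + v * R) = (u - i * v) * (R - i * M)"
    by (simp_all add: algebra_simps c)
qed

lemma cnj_op_Re_Im: "cnj_op c = Re_op c - const_op \<i> * Im_op c"
proof -
  have "cnj_op c = cnj_op (Re_op c + const_op \<i> * Im_op c)"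
    by (simp flip: Re_op_Im_op)
  then show ?thesis
    by (simp add: cnj_op_add cnj_op_mult cnj_op_const_op cnj_op_Re_op cnj_op_Im_op const_op_neg)
qed

text \<open>
  The two columns that a real form makes out of one column of \<open>c\<close>, combined with \<open>\<plusminus> \<i>\<close>, for left
  multiplications and then for right multiplications.
\<close>

lemma lmult_column:
  "u * lmult (Re_op c) + v * lmult (- Im_op c) + scal \<i> * (u * lmult (Im_op c) + v * lmult (Re_op c))
    = (u + scal \<i> * v) * lmult c"
  "u * lmult (Re_op c) + v * lmult (- Im_op c) - scal \<i> * (u * lmult (Im_op c) + v * lmult (Re_op c))
    = (u - scal \<i> * v) * lmult (cnj_op c)"
proof -
  have "lmult c = lmult (Re_op c) + scal \<i> * lmult (Im_op c)"
    by (subst Re_op_Im_op) (simp add: lmult_add lmult_mult scal_def)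
  moreover have "lmult (cnj_op c) = lmult (Re_op c) - scal \<i> * lmult (Im_op c)"
    using lmult_add[of "Re_op c" "- (const_op \<i> * Im_op c)"]
    by (simp add: cnj_op_Re_Im lmult_minus lmult_mult scal_def)
  ultimately show
    "u * lmult (Re_op c) + v * lmult (- Im_op c) + scal \<i> * (u * lmult (Im_op c) + v * lmult (Re_op c))
      = (u + scal \<i> * v) * lmult c"
    "u * lmult (Re_op c) + v * lmult (- Im_op c) - scal \<i> * (u * lmult (Im_op c) + v * lmult (Re_op c))
      = (u - scal \<i> * v) * lmult (cnj_op c)"
    unfolding lmult_minus by (simp_all only: complex_combination[OF scal_central scal_i_sq])
qed

lemma rmult_column:
  "u * rmult (Re_op c) + v * rmult (- Im_op c) + scal \<i> * (u * rmult (Im_op c) + v * rmult (Re_op c))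
    = (u + scal \<i> * v) * rmult c"
  "u * rmult (Re_op c) + v * rmult (- Im_op c) - scal \<i> * (u * rmult (Im_op c) + v * rmult (Re_op c))
    = (u - scal \<i> * v) * rmult (cnj_op c)"
proof -
  have "rmult c = rmult (Re_op c) + scal \<i> * rmult (Im_op c)"
    by (subst Re_op_Im_op) (simp add: rmult_add rmult_mult scal_rmult scal_central flip: scal_rmult)
  moreover have "rmult (cnj_op c) = rmult (Re_op c) - scal \<i> * rmult (Im_op c)"
    using rmult_add[of "Re_op c" "- (const_op \<i> * Im_op c)"]
    by (simp add: cnj_op_Re_Im rmult_minus rmult_mult scal_central flip: scal_rmult)
  ultimately show
    "u * rmult (Re_op c) + v * rmult (- Im_op c) + scal \<i> * (u * rmult (Im_op c) + v * rmult (Re_op c))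
      = (u + scal \<i> * v) * rmult c"
    "u * rmult (Re_op c) + v * rmult (- Im_op c) - scal \<i> * (u * rmult (Im_op c) + v * rmult (Re_op c))
      = (u - scal \<i> * v) * rmult (cnj_op c)"
    unfolding rmult_minus by (simp_all only: complex_combination[OF scal_central scal_i_sq])
qed

text \<open>
  The same combinations for a diagonal block of \<open>T\<close> with \<open>s = \<i>\<close>. The entries with denominator \<open>4\<close>
  cancel in the first combination and give the summand with \<open>1/2\<close> in the second.
\<close>

lemma T_column:
  fixes u v :: "'v diffop fock_op" and t :: nat
  defines "c \<equiv> (of_nat t :: complex)"
  shows "u * scal (c + 1 / 4) + v * scal (\<i> / 4) + scal \<i> * (u * scal (\<i> / 4) + v * scal (c - 1 / 4))
      = of_nat t * (u + scal \<i> * v)"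
    "u * scal (c + 1 / 4) + v * scal (\<i> / 4) - scal \<i> * (u * scal (\<i> / 4) + v * scal (c - 1 / 4))
      = of_nat t * (u - scal \<i> * v) + scal (1 / 2) * (u + scal \<i> * v)"
proof -
  have m: "scal x * (w * scal y) = w * scal (x * y)" for x y and w :: "'v diffop fock_op"
    by (simp only: scal_central[of x "w * scal y"] mult.assoc) (simp only: mult.commute[of x y] flip: scal_mult)
  have n: "of_nat t * w = w * scal c" for w :: "'v diffop fock_op"
    unfolding c_def scal_of_nat by (rule mult_of_nat_commute)
  have s: "scal x * w = w * scal x" for x and w :: "'v diffop fock_op"
    by (rule scal_central)
  have "u * scal (c + 1 / 4) + v * scal (\<i> / 4) + scal \<i> * (u * scal (\<i> / 4) + v * scal (c - 1 / 4))
      = u * scal (c + 1 / 4 + \<i> * (\<i> / 4)) + v * scal (\<i> / 4 + \<i> * (c - 1 / 4))"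
    by (simp only: distrib_left m scal_add add_ac)
  also have "\<dots> = of_nat t * (u + scal \<i> * v)"
    unfolding n s[of \<i>] distrib_right mult.assoc scal_mult[symmetric] by (simp add: algebra_simps)
  finally show "u * scal (c + 1 / 4) + v * scal (\<i> / 4) + scal \<i> * (u * scal (\<i> / 4) + v * scal (c - 1 / 4))
      = of_nat t * (u + scal \<i> * v)" .
  have "u * scal (c + 1 / 4) + v * scal (\<i> / 4) - scal \<i> * (u * scal (\<i> / 4) + v * scal (c - 1 / 4))
      = u * scal (c + 1 / 4 - \<i> * (\<i> / 4)) + v * scal (\<i> / 4 - \<i> * (c - 1 / 4))"
    by (simp only: distrib_left right_diff_distrib m scal_add scal_diff) (simp add: algebra_simps)
  also have "\<dots> = u * scal (c + 1 / 2) + v * scal (\<i> * (1 / 2) - \<i> * c)"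
    by (simp add: algebra_simps)
  also have "\<dots> = of_nat t * (u - scal \<i> * v) + scal (1 / 2) * (u + scal \<i> * v)"
    unfolding n s[of \<i>] s[of "1 / 2"] distrib_right left_diff_distrib mult.assoc scal_mult[symmetric]
    by (simp only: scal_add scal_diff distrib_left right_diff_distrib) (simp add: mult.commute)
  finally show "u * scal (c + 1 / 4) + v * scal (\<i> / 4) - scal \<i> * (u * scal (\<i> / 4) + v * scal (c - 1 / 4))
      = of_nat t * (u - scal \<i> * v) + scal (1 / 2) * (u + scal \<i> * v)" .
qed

section \<open>The holomorphic and the antiholomorphic family\<close>

lemma comm_cnj_op: "comm x y \<Longrightarrow> comm (cnj_op x) (cnj_op y)"
  by (simp add: comm_def flip: cnj_op_mult)

lemma comm_Re_Im_op:
  assumes "comm x y" "comm x (cnj_op y)"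
  shows "comm (Re_op x) (Re_op y)" "comm (Re_op x) (Im_op y)" "comm (Im_op x) (Re_op y)" "comm (Im_op x) (Im_op y)"
proof -
  have "comm (cnj_op x) y" "comm (cnj_op x) (cnj_op y)"
    using comm_cnj_op[OF assms(2)] comm_cnj_op[OF assms(1)] by (simp_all add: cnj_op_cnj_op)
  then show "comm (Re_op x) (Re_op y)" "comm (Re_op x) (Im_op y)" "comm (Im_op x) (Re_op y)" "comm (Im_op x) (Im_op y)"
    unfolding Re_op_def Im_op_def using assms
    by (auto intro!: comm_mult_left comm_mult_right const_op_comm comm_add_left comm_add_right
        comm_diff_left comm_diff_right)
qed

lemma real_form_entry_comm:
  assumes "\<And>i k j l. i < dim_row M \<Longrightarrow> k < dim_col M \<Longrightarrow> j < dim_row M \<Longrightarrow> l < dim_col M \<Longrightarrow>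
      comm (M $$ (i, k)) (M $$ (j, l)) \<and> comm (M $$ (i, k)) (cnj_op (M $$ (j, l)))"
    and "p < 2 * dim_row M" "q < 2 * dim_col M" "p' < 2 * dim_row M" "q' < 2 * dim_col M"
  shows "comm (real_form M $$ (p, q)) (real_form M $$ (p', q'))"
proof -
  have "comm (M $$ (p div 2, q div 2)) (M $$ (p' div 2, q' div 2))"
    "comm (M $$ (p div 2, q div 2)) (cnj_op (M $$ (p' div 2, q' div 2)))"
    using assms(1)[of "p div 2" "q div 2" "p' div 2" "q' div 2"] assms(2-) by (auto simp: less_mult_imp_div_less)
  note comm_Re_Im_op[OF this]
  then show ?thesis
    using assms(2-) by (simp add: real_form_def Let_def comm_uminus)
qed

text \<open>
  The commutation rules shared by the two cases; those not listed follow by conjugation. In Turnbull's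
  case \<open>symmetric\<close> holds.
\<close>

locale capelli_pair =
  fixes n :: nat and Z D :: "var diffop mat" and symmetric :: bool
  assumes Z_carrier: "Z \<in> carrier_mat n n" and D_carrier: "D \<in> carrier_mat n n"
    and Z_comm: "i < n \<Longrightarrow> k < n \<Longrightarrow> j < n \<Longrightarrow> l < n \<Longrightarrow> comm (Z $$ (i, k)) (Z $$ (j, l))"
      "i < n \<Longrightarrow> k < n \<Longrightarrow> j < n \<Longrightarrow> l < n \<Longrightarrow> comm (Z $$ (i, k)) (cnj_op (Z $$ (j, l)))"
    and D_comm: "i < n \<Longrightarrow> k < n \<Longrightarrow> j < n \<Longrightarrow> l < n \<Longrightarrow> comm (D $$ (i, k)) (D $$ (j, l))"
      "i < n \<Longrightarrow> k < n \<Longrightarrow> j < n \<Longrightarrow> l < n \<Longrightarrow> comm (D $$ (i, k)) (cnj_op (D $$ (j, l)))"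
    and D_cnj_Z: "i < n \<Longrightarrow> k < n \<Longrightarrow> j < n \<Longrightarrow> l < n \<Longrightarrow> comm (D $$ (j, k)) (cnj_op (Z $$ (i, l)))"
    and D_Z: "i < n \<Longrightarrow> k < n \<Longrightarrow> j < n \<Longrightarrow> l < n \<Longrightarrow>
      D $$ (j, k) * Z $$ (i, l) = Z $$ (i, l) * D $$ (j, k) + of_bool (j = i \<and> k = l)
        + of_bool (symmetric \<and> j = l \<and> k = i)"
    and Z_sym: "symmetric \<Longrightarrow> i < n \<Longrightarrow> k < n \<Longrightarrow> Z $$ (i, k) = Z $$ (k, i)"

locale capelli_minor = capelli_pair n Z D symmetric
  for n and Z D :: "var diffop mat" and symmetric +
  fixes I J :: "nat list" and r :: nat
  assumes I: "length I = r" "set I \<subseteq> {0..<n}" and J: "length J = r" "set J \<subseteq> {0..<n}"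
begin

lemma I_less: "a < r \<Longrightarrow> I ! a < n" and J_less: "a < r \<Longrightarrow> J ! a < n"
  using I J nth_mem[of a I] nth_mem[of a J] by (auto simp: subset_iff)

sublocale hol: capelli_family n r I J "\<lambda>a. gen (2 * a)" "\<lambda>i k. Z $$ (i, k)" "\<lambda>j k. D $$ (j, k)"
  symmetric "scal (1 / 2)"
  by unfold_locales
    (rule I_less J_less gen_acomm gen_comm_lmult gen_comm_rmult Z_comm(1) D_comm(1) D_Z Z_sym scal_half_add; assumption)+

sublocale anti: capelli_family n r I J "\<lambda>a. gen (Suc (2 * a))" "\<lambda>i k. cnj_op (Z $$ (i, k))"
  "\<lambda>j k. cnj_op (D $$ (j, k))" symmetric "scal (1 / 2)"
proof unfold_locales
  fix i k j l assume "i < n" "k < n" "j < n" "l < n"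
  from arg_cong[OF D_Z[OF this], of cnj_op]
  show "cnj_op (D $$ (j, k)) * cnj_op (Z $$ (i, l)) = cnj_op (Z $$ (i, l)) * cnj_op (D $$ (j, k))
      + of_bool (j = i \<and> k = l) + of_bool (symmetric \<and> j = l \<and> k = i)"
    by (simp only: cnj_op_add cnj_op_mult cnj_op_of_bool)
qed ((rule I_less J_less gen_acomm gen_comm_lmult gen_comm_rmult comm_cnj_op[OF Z_comm(1)]
    comm_cnj_op[OF D_comm(1)] scal_half_add arg_cong[OF Z_sym]; assumption)+)

text \<open>
  The two families anticommute, since the entries of \<open>Z\<close> and \<open>D\<close> commute with the conjugates of both.
\<close>

lemma cross_acomm:
  assumes "m < r" "j < r" "X \<in> {hol.column m, hol.normal_column m, hol.q m}"
    and "Y \<in> {anti.column j, anti.normal_column j, anti.q j}"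
  shows "acomm X Y"
proof -
  have Z_cnj_D: "comm (Z $$ (i, k)) (cnj_op (D $$ (j, l)))" if "i < n" "k < n" "j < n" "l < n" for i k j l
    using comm_cnj_op[OF D_cnj_Z[of i l j k]] that by (simp add: cnj_op_cnj_op comm_sym)
  note rules = acomm_sum_left acomm_sum_right acomm_mult_left acomm_mult_right comm_mult_right
    gen_acomm gen_comm_lmult gen_comm_rmult comm_sym[OF gen_comm_lmult] comm_sym[OF gen_comm_rmult]
    lmult_comm_rmult comm_sym[OF lmult_comm_rmult] hol.comm_lmult hol.comm_rmult hol.comm_of_bool
  have "acomm (hol.\<zeta> k) (anti.\<zeta> l)" if "k < n" "l < n" for k l
    unfolding hol.\<zeta>_def anti.\<zeta>_def by (intro rules) (use that I_less Z_comm(2) in auto)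
  moreover have "acomm (hol.\<zeta> k) (anti.q j)" if "k < n" for k
    unfolding hol.\<zeta>_def anti.q_def by (intro rules)
  moreover have "acomm (hol.q m) (anti.\<zeta> l)" if "l < n" for l
    unfolding hol.q_def anti.\<zeta>_def by (intro rules)
  moreover have "acomm (hol.q m) (anti.q j)"
    unfolding hol.q_def anti.q_def by (intro rules)
  moreover have "comm (hol.\<zeta> k) (lmult (cnj_op (D $$ (J ! j, l))))" if "k < n" "l < n" for k l
    unfolding hol.\<zeta>_def using that assms(2)
    by (auto intro!: comm_sum_left comm_mult_left gen_comm_lmult hol.comm_lmult Z_cnj_D I_less J_less)
  moreover have "comm (lmult (D $$ (J ! m, k))) (anti.\<zeta> l)" if "k < n" "l < n" for k l
    unfolding anti.\<zeta>_def using that assms(1)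
    by (auto intro!: comm_sum_right comm_mult_right comm_sym[OF gen_comm_lmult] hol.comm_lmult D_cnj_Z I_less J_less)
  moreover have "comm (hol.\<zeta> k) (rmult c)" "comm (rmult c) (anti.\<zeta> k)" for k c
    using hol.\<zeta>_comm_rmult comm_sym[OF anti.\<zeta>_comm_rmult] by auto
  moreover have "comm (hol.q m) (rmult c)" "comm (hol.q m) (lmult c)"
    "comm (rmult c) (anti.q j)" "comm (lmult c) (anti.q j)" for c
    using hol.q_comm anti.q_comm comm_sym by blast+
  moreover have "comm (lmult (D $$ (J ! m, k))) (lmult (cnj_op (D $$ (J ! j, l))))"
    "comm (rmult (D $$ (J ! m, k))) (rmult (cnj_op (D $$ (J ! j, l))))" if "k < n" "l < n" for k l
    using that assms(1,2) by (auto intro!: hol.comm_lmult hol.comm_rmult D_comm J_less)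
  moreover note lmult_comm_rmult comm_sym[OF lmult_comm_rmult]
  ultimately show ?thesis
    using assms(3,4) unfolding hol.column_def hol.normal_column_def anti.column_def anti.normal_column_def
    by (auto intro!: acomm_sum_left acomm_sum_right acomm_mult_left acomm_mult_right comm_sum_left
        comm_sum_right comm_mult_left comm_mult_right)
qed

lemma odd_degree_ge_scal: "X \<in> odd_degree_ge k \<Longrightarrow> scal c * X \<in> odd_degree_ge k"
  by (simp add: scal_def odd_degree_ge_lmult)

sublocale families: two_capelli_families "scal \<i>" "scal (1 / 2)" ann odd_degree_ge r
  hol.column hol.normal_column hol.q anti.column anti.normal_column anti.q
proof unfold_locales
  fix m k and X :: "var diffop fock_op"
  assume X: "X \<in> odd_degree_ge k"
  have even: "gen (2 * a) * Y \<in> odd_degree_ge k" if "Y \<in> odd_degree_ge k" for a and Y :: "var diffop fock_op"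
    using odd_degree_ge_gen[OF that, of "2 * a"] by simp
  have odd: "gen (Suc (2 * a)) * Y \<in> odd_degree_ge (Suc k)" if "Y \<in> odd_degree_ge k" for a and Y :: "var diffop fock_op"
    using odd_degree_ge_gen[OF that, of "Suc (2 * a)"] by simp
  show "hol.column m * X \<in> odd_degree_ge k" "hol.normal_column m * X \<in> odd_degree_ge k" "hol.q m * X \<in> odd_degree_ge k"
    by (intro hol.degree_shift[OF even X]; assumption)+
  show "anti.column m * X \<in> odd_degree_ge (Suc k)" "anti.normal_column m * X \<in> odd_degree_ge (Suc k)"
    "anti.q m * X \<in> odd_degree_ge (Suc k)"
    by (intro anti.degree_shift[OF odd X]; assumption)+
next
  fix m assume m: "m < r"
  show "acomm (hol.column m) (hol.q m)"
    by (rule acomm_sym[OF hol.q_column_acomm[OF m]])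
next
  show "acomm X Y" if "m < r" "j < r" "X \<in> {hol.column m, hol.normal_column m, hol.q m}"
    "Y \<in> {anti.column j, anti.normal_column j, anti.q j}" for m j X Y
    by (rule cross_acomm[OF that])
qed (auto intro: scal_central scal_i_sq scal_half_add ann_0 ann_add ann_mult odd_degree_ge_1
    odd_degree_ge_ann odd_degree_ge_add odd_degree_ge_scal odd_degree_ge_mono
    hol.column_minus_normal_column anti.column_minus_normal_column hol.column_normal_column anti.column_normal_column hol.column_sq
    hol.normal_column_acomm anti.normal_column_acomm hol.q_normal_column_acomm anti.q_normal_column_acomm hol.q_acomm)

abbreviation corrected :: "var diffop mat" where
  "corrected \<equiv> real_form (minor_mat (Z * transpose_mat D) I J) + real_form (Q_mat I J) * T_mat \<i> r"

text \<open>
  The columns of the matrix on the left-hand side, as operators on Fock space. With \<open>eta\<close> for the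
  columns of the rows \<open>I\<close> of the real form of \<open>Z\<close>, \<open>normal_col\<close> is the normally ordered counterpart
  that leads to the right-hand side.
\<close>

definition corrected_col :: "nat \<Rightarrow> var diffop fock_op" where
  "corrected_col k = (\<Sum>p<2 * r. psi p * lmult (corrected $$ (p, k)))"

definition eta :: "nat \<Rightarrow> var diffop fock_op" where
  "eta p = (\<Sum>s<2 * r. psi s * lmult (real_form Z $$ (real_index I ! s, p)))"

definition normal_col :: "nat \<Rightarrow> var diffop fock_op" where
  "normal_col k = (\<Sum>p<2 * n. eta p * rmult (real_form (transpose_mat D) $$ (p, real_index J ! k)))"

lemma eta_combination:
  assumes "k < n"
  shows "eta (2 * k) + scal \<i> * eta (Suc (2 * k)) = hol.\<zeta> k"
    "eta (2 * k) - scal \<i> * eta (Suc (2 * k)) = anti.\<zeta> k"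
proof -
  have e: "real_form Z $$ (real_index I ! (2 * a), 2 * k) = Re_op (Z $$ (I ! a, k))"
    "real_form Z $$ (real_index I ! (2 * a), Suc (2 * k)) = Im_op (Z $$ (I ! a, k))"
    "real_form Z $$ (real_index I ! Suc (2 * a), 2 * k) = - Im_op (Z $$ (I ! a, k))"
    "real_form Z $$ (real_index I ! Suc (2 * a), Suc (2 * k)) = Re_op (Z $$ (I ! a, k))" if "a < r" for a
    using real_form_index[of "I ! a" Z k] real_index_nth[of a I] I_less[OF that] I(1) that assms Z_carrier
    by auto
  have "eta (2 * k) = (\<Sum>a<r. psi (2 * a) * lmult (Re_op (Z $$ (I ! a, k)))
      + psi (Suc (2 * a)) * lmult (- Im_op (Z $$ (I ! a, k))))"
    "eta (Suc (2 * k)) = (\<Sum>a<r. psi (2 * a) * lmult (Im_op (Z $$ (I ! a, k)))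
      + psi (Suc (2 * a)) * lmult (Re_op (Z $$ (I ! a, k))))"
    unfolding eta_def sum_pairs by (intro sum.cong refl; simp add: e)+
  note eta = this
  show "eta (2 * k) + scal \<i> * eta (Suc (2 * k)) = hol.\<zeta> k"
    unfolding eta sum_distrib_left sum.distrib[symmetric] lmult_column psi_gen hol.\<zeta>_def ..
  show "eta (2 * k) - scal \<i> * eta (Suc (2 * k)) = anti.\<zeta> k"
    unfolding eta sum_distrib_left sum_subtractf[symmetric] lmult_column psi_gen anti.\<zeta>_def ..
qed

lemma normal_col_combination:
  assumes "m < r"
  shows "normal_col (2 * m) + scal \<i> * normal_col (2 * m + 1) = hol.normal_column m"
    "normal_col (2 * m) - scal \<i> * normal_col (2 * m + 1) = anti.normal_column m"
proof -
  let ?d = "\<lambda>k. D $$ (J ! m, k)"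
  have e: "real_form (transpose_mat D) $$ (2 * k, real_index J ! (2 * m)) = Re_op (?d k)"
    "real_form (transpose_mat D) $$ (2 * k, real_index J ! Suc (2 * m)) = Im_op (?d k)"
    "real_form (transpose_mat D) $$ (Suc (2 * k), real_index J ! (2 * m)) = - Im_op (?d k)"
    "real_form (transpose_mat D) $$ (Suc (2 * k), real_index J ! Suc (2 * m)) = Re_op (?d k)" if "k < n" for k
    using real_form_index[of k "transpose_mat D" "J ! m"] real_index_nth[of m J] J_less[OF assms] J(1)
      that assms D_carrier by auto
  have "normal_col (2 * m) = (\<Sum>k<n. eta (2 * k) * rmult (Re_op (?d k)) + eta (Suc (2 * k)) * rmult (- Im_op (?d k)))"
    "normal_col (2 * m + 1) = (\<Sum>k<n. eta (2 * k) * rmult (Im_op (?d k)) + eta (Suc (2 * k)) * rmult (Re_op (?d k)))"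
    unfolding normal_col_def sum_pairs by (intro sum.cong refl; simp add: e)+
  note N = this
  show "normal_col (2 * m) + scal \<i> * normal_col (2 * m + 1) = hol.normal_column m"
    unfolding N sum_distrib_left sum.distrib[symmetric] rmult_column hol.normal_column_def
    by (intro sum.cong refl) (simp add: eta_combination)
  show "normal_col (2 * m) - scal \<i> * normal_col (2 * m + 1) = anti.normal_column m"
    unfolding N sum_distrib_left sum_subtractf[symmetric] rmult_column anti.normal_column_def
    by (intro sum.cong refl) (simp add: eta_combination)
qed

lemma corrected_carrier: "corrected \<in> carrier_mat (2 * r) (2 * r)"
  using T_mat_carrier[of \<i> r] by (intro carrier_matI) (auto simp: real_form_def minor_mat_def Q_mat_def I J)

lemma corrected_col_combination:
  assumes m: "m < r"
  shows "corrected_col (2 * m) + scal \<i> * corrected_col (Suc (2 * m)) = hol.column m + of_nat (r - Suc m) * hol.q m"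
    "corrected_col (2 * m) - scal \<i> * corrected_col (Suc (2 * m))
      = anti.column m + of_nat (r - Suc m) * anti.q m + scal (1 / 2) * hol.q m"
proof -
  define e where "e a = (\<Sum>k<n. Z $$ (I ! a, k) * D $$ (J ! m, k))" for a
  define b :: "nat \<Rightarrow> var diffop fock_op" where "b a = lmult (of_bool (I ! a = J ! m))" for a
  define c :: complex where "c = of_nat (r - Suc m)"
  let ?M = "minor_mat (Z * transpose_mat D) I J"
  have M: "?M $$ (a, m) = e a" if "a < r" for a
    using that m I J I_less J_less Z_carrier D_carrier
    by (simp add: minor_mat_def e_def scalar_prod_def lessThan_atLeast0)
  have c: "of_nat r - of_nat (Suc m) = c"
    using m by (simp add: c_def of_nat_diff)
  have T: "T_block \<i> r (Suc m) $$ (0, 0) = c + 1 / 4" "T_block \<i> r (Suc m) $$ (0, Suc 0) = \<i> / 4"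
    "T_block \<i> r (Suc m) $$ (Suc 0, 0) = \<i> / 4" "T_block \<i> r (Suc m) $$ (Suc 0, Suc 0) = c - 1 / 4"
    by (simp_all only: T_block_def c) (simp_all add: mat_of_rows_list_def)
  have entry: "lmult (corrected $$ (2 * a + u, 2 * m + v))
      = lmult (real_form ?M $$ (2 * a + u, 2 * m + v)) + b a * scal (T_block \<i> r (Suc m) $$ (u, v))"
    if "a < r" "u < 2" "v < 2" for a u v
  proof -
    have "corrected $$ (2 * a + u, 2 * m + v) = real_form ?M $$ (2 * a + u, 2 * m + v)
        + (real_form (Q_mat I J) * T_mat \<i> r) $$ (2 * a + u, 2 * m + v)"
      using that m T_mat_carrier[of \<i> r] by (intro index_add_mat) (auto simp: real_form_def Q_mat_def I J)
    then show ?thesis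
      using that m by (simp only: Q_T_index[OF I(1) J(1)] lmult_add lmult_mult b_def scal_def)
  qed
  have entries: "lmult (corrected $$ (2 * a, 2 * m)) = lmult (Re_op (e a)) + b a * scal (c + 1 / 4)"
    "lmult (corrected $$ (2 * a, Suc (2 * m))) = lmult (Im_op (e a)) + b a * scal (\<i> / 4)"
    "lmult (corrected $$ (Suc (2 * a), 2 * m)) = lmult (- Im_op (e a)) + b a * scal (\<i> / 4)"
    "lmult (corrected $$ (Suc (2 * a), Suc (2 * m))) = lmult (Re_op (e a)) + b a * scal (c - 1 / 4)" if "a < r" for a
    using entry[OF that, of 0 0] entry[OF that, of 0 1] entry[OF that, of 1 0] entry[OF that, of 1 1]
      real_form_index[of a ?M m] M[OF that] that m
    by (simp_all add: T minor_mat_def I J del: index_add_mat)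
  define x y where "x a = psi (2 * a) * b a" and "y a = psi (Suc (2 * a)) * b a" for a
  have corrected_col: "corrected_col (2 * m) = (\<Sum>a<r. (psi (2 * a) * lmult (Re_op (e a)) + psi (Suc (2 * a)) * lmult (- Im_op (e a)))
      + (x a * scal (c + 1 / 4) + y a * scal (\<i> / 4)))"
    "corrected_col (Suc (2 * m)) = (\<Sum>a<r. (psi (2 * a) * lmult (Im_op (e a)) + psi (Suc (2 * a)) * lmult (Re_op (e a)))
      + (x a * scal (\<i> / 4) + y a * scal (c - 1 / 4)))"
    unfolding corrected_col_def sum_pairs
    by (intro sum.cong refl; simp only: lessThan_iff entries x_def y_def distrib_left mult.assoc add_ac)+
  have xy: "x a + scal \<i> * y a = gen (2 * a) * b a" "x a - scal \<i> * y a = gen (Suc (2 * a)) * b a" for a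
    unfolding psi_gen[symmetric] by (simp_all add: x_def y_def distrib_right left_diff_distrib mult.assoc)
  have "cnj_op (e a) = (\<Sum>k<n. cnj_op (Z $$ (I ! a, k)) * cnj_op (D $$ (J ! m, k)))" for a
    by (simp add: e_def cnj_op_sum cnj_op_mult)
  then have expand: "hol.column m = (\<Sum>a<r. gen (2 * a) * lmult (e a))"
    "anti.column m = (\<Sum>a<r. gen (Suc (2 * a)) * lmult (cnj_op (e a)))"
    "hol.q m = (\<Sum>a<r. gen (2 * a) * b a)" "anti.q m = (\<Sum>a<r. gen (Suc (2 * a)) * b a)"
    by (simp_all add: hol.column_expand anti.column_expand hol.q_def anti.q_def e_def b_def)
  have "corrected_col (2 * m) + scal \<i> * corrected_col (Suc (2 * m))
      = (\<Sum>a<r. (psi (2 * a) * lmult (Re_op (e a)) + psi (Suc (2 * a)) * lmult (- Im_op (e a))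
          + scal \<i> * (psi (2 * a) * lmult (Im_op (e a)) + psi (Suc (2 * a)) * lmult (Re_op (e a))))
        + (x a * scal (c + 1 / 4) + y a * scal (\<i> / 4)
          + scal \<i> * (x a * scal (\<i> / 4) + y a * scal (c - 1 / 4))))"
    unfolding corrected_col sum_distrib_left sum.distrib[symmetric] by (simp only: distrib_left add_ac)
  also have "\<dots> = hol.column m + of_nat (r - Suc m) * hol.q m"
    unfolding lmult_column psi_gen c_def T_column xy by (simp only: expand sum.distrib sum_distrib_left)
  finally show "corrected_col (2 * m) + scal \<i> * corrected_col (Suc (2 * m)) = hol.column m + of_nat (r - Suc m) * hol.q m" .
  have "corrected_col (2 * m) - scal \<i> * corrected_col (Suc (2 * m))
      = (\<Sum>a<r. (psi (2 * a) * lmult (Re_op (e a)) + psi (Suc (2 * a)) * lmult (- Im_op (e a))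
          - scal \<i> * (psi (2 * a) * lmult (Im_op (e a)) + psi (Suc (2 * a)) * lmult (Re_op (e a))))
        + (x a * scal (c + 1 / 4) + y a * scal (\<i> / 4)
          - scal \<i> * (x a * scal (\<i> / 4) + y a * scal (c - 1 / 4))))"
    unfolding corrected_col sum_distrib_left sum_subtractf[symmetric]
    by (intro sum.cong refl) (simp only: distrib_left add_diff_add)
  also have "\<dots> = anti.column m + of_nat (r - Suc m) * anti.q m + scal (1 / 2) * hol.q m"
    unfolding lmult_column psi_gen c_def T_column xy by (simp only: expand sum.distrib sum_distrib_left add.assoc)
  finally show "corrected_col (2 * m) - scal \<i> * corrected_col (Suc (2 * m))
      = anti.column m + of_nat (r - Suc m) * anti.q m + scal (1 / 2) * hol.q m" .
qed

end

section \<open>Vacuum values of the two products\<close>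

lemma col_det_lmult: "col_det (mat N N (\<lambda>(a, k). lmult (M a k))) = lmult (col_det (mat N N (\<lambda>(a, k). M a k)))"
proof (rule col_det_map[OF lmult_add])
  have "lmult (prod_list (map g ks)) = prod_list (map (\<lambda>k. lmult (g k)) ks)" for g :: "nat \<Rightarrow> 'a" and ks
    by (induction ks) (simp_all add: lmult_1 lmult_mult)
  then show "lmult (prod_list (map (\<lambda>k. M (\<sigma> k) k) [0..<N])) = prod_list (map (\<lambda>k. lmult (M (\<sigma> k) k)) [0..<N])"
    for \<sigma> .
qed

lemma col_det_rmult:
  assumes "\<And>a k b l. a < N \<Longrightarrow> k < N \<Longrightarrow> b < N \<Longrightarrow> l < N \<Longrightarrow> comm (M a k) (M b l)"
  shows "col_det (mat N N (\<lambda>(a, k). rmult (M a k))) = rmult (col_det (mat N N (\<lambda>(a, k). M a k)))"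
proof (rule col_det_map[OF rmult_add])
  have c: "rmult (prod_list xs) = prod_list (map rmult xs)"
    if "\<And>x y. x \<in> set xs \<Longrightarrow> y \<in> set xs \<Longrightarrow> comm x y" for xs :: "'a list"
    using that
  proof (induction xs)
    case (Cons x xs)
    have "comm x (prod_list xs)"
      using Cons.prems by (intro comm_prod_list) simp
    then have "rmult (x * prod_list xs) = rmult (prod_list xs * x)"
      by (simp add: comm_def)
    then show ?case
      using Cons by (simp add: rmult_mult)
  qed (simp add: rmult_1)
  fix \<sigma> assume \<sigma>: "\<sigma> permutes {0..<N}"
  have "\<sigma> k < N" if "k < N" for k
    using permutes_in_image[OF \<sigma>, of k] that by simp
  then have "rmult (prod_list (map (\<lambda>k. M (\<sigma> k) k) [0..<N])) = prod_list (map rmult (map (\<lambda>k. M (\<sigma> k) k) [0..<N]))"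
    by (intro c) (auto intro: assms)
  then show "rmult (prod_list (map (\<lambda>k. M (\<sigma> k) k) [0..<N])) = prod_list (map (\<lambda>k. rmult (M (\<sigma> k) k)) [0..<N])"
    by (simp add: comp_def)
qed

lemma word_psi_sum:
  "word (\<lambda>k. \<Sum>p<N. psi p * lmult (M p k)) [0..<N]
    = word psi [0..<N] * lmult (col_det (mat N N (\<lambda>(a, k). M a k)))"
proof -
  have "word (\<lambda>k. \<Sum>p<N. psi p * lmult (M p k)) [0..<N]
      = (\<Sum>L\<in>increasing_indices N N. word psi L * col_det (mat N N (\<lambda>(a, k). lmult (M (L ! a) k))))"
    unfolding word_def[of "\<lambda>k. \<Sum>p<N. psi p * lmult (M p k)"]
    by (rule prod_sum_col_det[OF comm_sym[OF psi_comm(1)] psi_acomm psi_sq])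
  also have "mat N N (\<lambda>(a, k). lmult (M ([0..<N] ! a) k)) = mat N N (\<lambda>(a, k). lmult (M a k))"
    by (intro eq_matI) auto
  then have "(\<Sum>L\<in>increasing_indices N N. word psi L * col_det (mat N N (\<lambda>(a, k). lmult (M (L ! a) k))))
      = word psi [0..<N] * lmult (col_det (mat N N (\<lambda>(a, k). M a k)))"
    by (simp add: increasing_indices_full col_det_lmult)
  finally show ?thesis .
qed

lemma cnj_op_col_det: "cnj_op (col_det (mat N N (\<lambda>(a, k). M a k))) = col_det (mat N N (\<lambda>(a, k). cnj_op (M a k)))"
proof (rule col_det_map[OF cnj_op_add, symmetric])
  have "cnj_op (prod_list (map g ks)) = prod_list (map (\<lambda>k. cnj_op (g k)) ks)" for g :: "nat \<Rightarrow> 'a diffop" and ks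
    by (induction ks) (simp_all add: cnj_op_1 cnj_op_mult)
  then show "cnj_op (prod_list (map (\<lambda>k. M (\<sigma> k) k) [0..<N])) = prod_list (map (\<lambda>k. cnj_op (M (\<sigma> k) k)) [0..<N])"
    for \<sigma> .
qed

context capelli_minor
begin

lemma real_index_less:
  "k < 2 * r \<Longrightarrow> real_index I ! k < 2 * n" "k < 2 * r \<Longrightarrow> real_index J ! k < 2 * n"
  using real_index_nth_less[OF I(2)] real_index_nth_less[OF J(2)] I(1) J(1) by simp_all

lemma real_form_Z_comm:
  "p < 2 * n \<Longrightarrow> q < 2 * n \<Longrightarrow> p' < 2 * n \<Longrightarrow> q' < 2 * n \<Longrightarrow>
    comm (real_form Z $$ (p, q)) (real_form Z $$ (p', q'))"
  by (rule real_form_entry_comm) (use Z_carrier Z_comm in auto)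

lemma real_form_D_comm:
  "p < 2 * n \<Longrightarrow> q < 2 * n \<Longrightarrow> p' < 2 * n \<Longrightarrow> q' < 2 * n \<Longrightarrow>
    comm (real_form (transpose_mat D) $$ (p, q)) (real_form (transpose_mat D) $$ (p', q'))"
  by (rule real_form_entry_comm) (use D_carrier D_comm in auto)

lemma eta_acomm:
  assumes "p < 2 * n" "q < 2 * n"
  shows "acomm (eta p) (eta q)"
  unfolding eta_def
  by (intro acomm_sum_left acomm_sum_right acomm_mult_left acomm_mult_right comm_mult_right
      psi_acomm psi_comm comm_sym[OF psi_comm(1)] hol.comm_lmult real_form_Z_comm)
    (use assms real_index_less(1) in auto)

lemma eta_comm_rmult: "comm (rmult c) (eta p)"
  unfolding eta_def
  by (intro comm_sum_right comm_mult_right comm_sym[OF psi_comm(2)] comm_sym[OF lmult_comm_rmult])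

lemma word_corrected_col: "word corrected_col [0..<2 * r] = word psi [0..<2 * r] * lmult (col_det corrected)"
proof -
  have "corrected = mat (2 * r) (2 * r) (\<lambda>(a, k). corrected $$ (a, k))"
    using corrected_carrier by (intro eq_matI) auto
  then show ?thesis
    using word_psi_sum[where N = "2 * r" and M = "\<lambda>p k. corrected $$ (p, k)"] unfolding corrected_col_def[abs_def] by simp
qed

lemma word_eta:
  assumes "L \<in> increasing_indices (2 * r) (2 * n)"
  shows "word eta L = word psi [0..<2 * r] * lmult (col_det (minor_mat (real_form Z) (real_index I) L))"
proof -
  have L: "length L = 2 * r" by (rule length_increasing(1)[OF assms])
  then have "word eta L = word (\<lambda>k. eta (L ! k)) [0..<2 * r]"
    by (metis map_nth word_map)
  also have "\<dots> = word psi [0..<2 * r]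
      * lmult (col_det (mat (2 * r) (2 * r) (\<lambda>(a, k). real_form Z $$ (real_index I ! a, L ! k))))"
    unfolding eta_def by (rule word_psi_sum)
  finally show ?thesis
    by (simp add: minor_mat_def length_real_index I(1) L)
qed

lemma word_normal_col:
  "word normal_col [0..<2 * r] = (\<Sum>L\<in>increasing_indices (2 * r) (2 * n).
    word eta L * rmult (col_det (minor_mat (real_form (transpose_mat D)) L (real_index J))))"
proof -
  let ?D = "real_form (transpose_mat D)"
  have "word normal_col [0..<2 * r] = prod_list (map (\<lambda>k. \<Sum>p<2 * n. eta p * rmult (?D $$ (p, real_index J ! k))) [0..<2 * r])"
    by (simp add: word_def normal_col_def[abs_def])
  also have "\<dots> = (\<Sum>L\<in>increasing_indices (2 * r) (2 * n).
      word eta L * col_det (mat (2 * r) (2 * r) (\<lambda>(a, k). rmult (?D $$ (L ! a, real_index J ! k)))))"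
    by (rule prod_sum_col_det)
      (auto intro: eta_comm_rmult eta_acomm half_acomm_self[OF scal_half_add])
  also have "\<dots> = (\<Sum>L\<in>increasing_indices (2 * r) (2 * n).
      word eta L * rmult (col_det (minor_mat ?D L (real_index J))))"
  proof (intro sum.cong refl)
    fix L assume L: "L \<in> increasing_indices (2 * r) (2 * n)"
    have "col_det (mat (2 * r) (2 * r) (\<lambda>(a, k). rmult (?D $$ (L ! a, real_index J ! k))))
      = rmult (col_det (mat (2 * r) (2 * r) (\<lambda>(a, k). ?D $$ (L ! a, real_index J ! k))))"
      by (intro col_det_rmult real_form_D_comm length_increasing(2)[OF L] real_index_less(2))
    then show "word eta L * col_det (mat (2 * r) (2 * r) (\<lambda>(a, k). rmult (?D $$ (L ! a, real_index J ! k))))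
      = word eta L * rmult (col_det (minor_mat ?D L (real_index J)))"
      by (simp add: minor_mat_def length_real_index J(1) length_increasing(1)[OF L])
  qed
  finally show ?thesis .
qed

text \<open>
  The two products agree at the top monomial because their difference has odd degree greater
  than \<open>r\<close> there. The common constant \<open>(\<i> / 2)\<^sup>r\<close> is then cancelled.
\<close>

theorem capelli_identity:
  "col_det corrected = (\<Sum>L\<in>increasing_indices (2 * r) (2 * n).
      col_det (minor_mat (real_form Z) (real_index I) L)
      * col_det (minor_mat (real_form (transpose_mat D)) L (real_index J)))"
proof -
  let ?S = "{0..<2 * r}" and ?w = "word psi [0..<2 * r] :: var diffop fock_op"
  let ?cZ = "\<lambda>L. col_det (minor_mat (real_form Z) (real_index I) L)"
  let ?cD = "\<lambda>L. col_det (minor_mat (real_form (transpose_mat D)) L (real_index J))"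
  define k :: "var diffop" where "k = const_op (\<i> / 2) ^ r"
  have c: "comm (lmult c) (word psi ks)" for c :: "var diffop" and ks
    unfolding word_def by (rule comm_prod_list) (auto intro: comm_sym[OF psi_comm(1)])
  have eval_vac: "app (?w * lmult c) vac ?S = c * k" for c
  proof -
    have "?w * lmult c = lmult c * ?w"
      using c[of c] by (simp add: comm_def)
    then show ?thesis
      by (simp add: app_simps app_word_psi k_def)
  qed
  have "word corrected_col [0..<2 * r] - word normal_col [0..<2 * r] \<in> odd_degree_ge (Suc r)"
    by (rule families.corrected_word_eq_normal_word)
      (simp_all add: corrected_col_combination normal_col_combination[unfolded Suc_eq_plus1[symmetric]])
  from odd_degree_ge_top[OF this]
  have "col_det corrected * k = app (word normal_col [0..<2 * r]) vac ?S"
    using eval_vac[of "col_det corrected"] by (simp add: word_corrected_col app_simps)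
  also have "\<dots> = (\<Sum>L\<in>increasing_indices (2 * r) (2 * n). app (word eta L * rmult (?cD L)) vac ?S)"
  proof -
    have "app (sum f A) vac ?S = (\<Sum>L\<in>A. app (f L) vac ?S)" for f :: "nat list \<Rightarrow> var diffop fock_op" and A
      by (induction A rule: infinite_finite_induct) (simp_all add: app_simps)
    then show ?thesis
      by (simp only: word_normal_col)
  qed
  also have "\<dots> = (\<Sum>L\<in>increasing_indices (2 * r) (2 * n). ?cZ L * ?cD L * k)"
  proof (intro sum.cong refl)
    fix L assume L: "L \<in> increasing_indices (2 * r) (2 * n)"
    have vac: "app (rmult c) vac = app (lmult c) vac" for c :: "var diffop"
      by (simp add: fun_eq_iff app_simps vac_def)
    have "app (word eta L * rmult (?cD L)) vac ?S = app (?w * lmult (?cZ L) * lmult (?cD L)) vac ?S"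
      unfolding word_eta[OF L] times_fock_op.rep_eq vac ..
    also have "\<dots> = app (?w * lmult (?cZ L * ?cD L)) vac ?S"
      by (simp only: lmult_mult mult.assoc)
    finally show "app (word eta L * rmult (?cD L)) vac ?S = ?cZ L * ?cD L * k"
      by (simp only: eval_vac)
  qed
  finally have "col_det corrected * k = (\<Sum>L\<in>increasing_indices (2 * r) (2 * n). ?cZ L * ?cD L) * k"
    by (simp only: sum_distrib_right)
  then have "col_det corrected * k * const_op (- 2 * \<i>) ^ r
      = (\<Sum>L\<in>increasing_indices (2 * r) (2 * n). ?cZ L * ?cD L) * k * const_op (- 2 * \<i>) ^ r"
    by (simp only:)
  moreover have "k * const_op (- 2 * \<i>) ^ r = 1"
    unfolding k_def by (rule left_right_inverse_power) (simp add: const_op_mult const_op_1)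
  ultimately show ?thesis
    by (simp only: mult.assoc mult_1_right)
qed

lemma cnj_real_form: "map_mat cnj_op (real_form M) = real_form M"
  by (intro eq_matI) (auto simp: real_form_def Let_def cnj_op_Re_op cnj_op_Im_op cnj_op_minus)

text \<open>
  A minor of a real form is a real operator.
\<close>

lemma cnj_minor:
  assumes "length K = N" "length L = N" "\<And>a. a < N \<Longrightarrow> K ! a < dim_row (real_form M)"
    "\<And>a. a < N \<Longrightarrow> L ! a < dim_col (real_form M)"
  shows "cnj_op (col_det (minor_mat (real_form M) K L)) = col_det (minor_mat (real_form M) K L)"
proof -
  have "cnj_op (real_form M $$ (p, q)) = real_form M $$ (p, q)"
    if "p < dim_row (real_form M)" "q < dim_col (real_form M)" for p q
    using arg_cong[OF cnj_real_form[of M], of "\<lambda>A. A $$ (p, q)"] that by simp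
  then have "mat N N (\<lambda>(a, k). cnj_op (real_form M $$ (K ! a, L ! k))) = mat N N (\<lambda>(a, k). real_form M $$ (K ! a, L ! k))"
    using assms(3,4) by (intro eq_matI) auto
  then show ?thesis
    unfolding minor_mat_def assms(1,2) cnj_op_col_det by simp
qed

theorem capelli_identity_conjugate:
  "col_det (real_form (minor_mat (Z * transpose_mat D) I J) + real_form (Q_mat I J) * T_mat (- \<i>) r)
    = (\<Sum>L\<in>increasing_indices (2 * r) (2 * n).
      col_det (minor_mat (real_form Z) (real_index I) L)
      * col_det (minor_mat (real_form (transpose_mat D)) L (real_index J)))" (is "col_det ?M = _")
proof -
  let ?A = "real_form (minor_mat (Z * transpose_mat D) I J)" and ?R = "real_form (Q_mat I J)"
  have dims: "?A \<in> carrier_mat (2 * r) (2 * r)" "?R \<in> carrier_mat (2 * r) (2 * r)"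
    by (auto simp: real_form_def minor_mat_def Q_mat_def I J)
  have M: "?M \<in> carrier_mat (2 * r) (2 * r)"
    using dims T_mat_carrier[of "- \<i>" r] by auto
  have entry: "cnj_op (corrected $$ (p, q)) = ?M $$ (p, q)" if "p < 2 * r" "q < 2 * r" for p q
  proof -
    define a u m v where "a = p div 2" and "u = p mod 2" and "m = q div 2" and "v = q mod 2"
    have p: "p = 2 * a + u" "u < 2" "a < r" and q: "q = 2 * m + v" "v < 2" "m < r"
      using that by (auto simp: a_def u_def m_def v_def)
    have "cnj (T_block \<i> r (Suc m) $$ (u, v)) = T_block (- \<i>) r (Suc m) $$ (u, v)"
    proof -
      have "u = 0 \<or> u = 1" "v = 0 \<or> v = 1" using p(2) q(2) by auto
      then show ?thesis by (auto simp: T_block_def mat_of_rows_list_def)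
    qed
    then have "cnj_op ((?R * T_mat \<i> r) $$ (p, q)) = (?R * T_mat (- \<i>) r) $$ (p, q)"
      unfolding p(1) q(1) Q_T_index[OF I(1) J(1) p(3) q(3) p(2) q(2)]
      by (simp only: cnj_op_mult cnj_op_of_bool cnj_op_const_op)
    moreover have "cnj_op (?A $$ (p, q)) = ?A $$ (p, q)"
      using arg_cong[OF cnj_real_form[of "minor_mat (Z * transpose_mat D) I J"], of "\<lambda>A. A $$ (p, q)"]
        that dims(1) by simp
    ultimately show ?thesis
      using that dims T_mat_carrier[of \<i> r] T_mat_carrier[of "- \<i>" r] by (simp add: cnj_op_add del: index_mult_mat(1))
  qed
  have "col_det ?M = cnj_op (col_det corrected)"
  proof -
    have "?M = mat (2 * r) (2 * r) (\<lambda>(a, k). cnj_op (corrected $$ (a, k)))"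
      using M entry by (intro eq_matI) auto
    moreover have "corrected = mat (2 * r) (2 * r) (\<lambda>(a, k). corrected $$ (a, k))"
      using corrected_carrier by (intro eq_matI) auto
    ultimately show ?thesis
      using cnj_op_col_det[where N = "2 * r" and M = "\<lambda>a k. corrected $$ (a, k)"] by simp
  qed
  also have "\<dots> = (\<Sum>L\<in>increasing_indices (2 * r) (2 * n).
      col_det (minor_mat (real_form Z) (real_index I) L)
      * col_det (minor_mat (real_form (transpose_mat D)) L (real_index J)))"
    unfolding capelli_identity cnj_op_sum cnj_op_mult
  proof (intro sum.cong refl arg_cong2[where f = "(*)"])
    fix L assume L: "L \<in> increasing_indices (2 * r) (2 * n)"
    show "cnj_op (col_det (minor_mat (real_form Z) (real_index I) L)) = col_det (minor_mat (real_form Z) (real_index I) L)"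
      by (rule cnj_minor[where N = "2 * r"])
        (use Z_carrier length_increasing[OF L] real_index_less(1) in \<open>auto simp: real_form_def length_real_index I\<close>)
    show "cnj_op (col_det (minor_mat (real_form (transpose_mat D)) L (real_index J)))
      = col_det (minor_mat (real_form (transpose_mat D)) L (real_index J))"
      by (rule cnj_minor[where N = "2 * r"])
        (use D_carrier length_increasing[OF L] real_index_less(2) in \<open>auto simp: real_form_def length_real_index J\<close>)
  qed
  finally show ?thesis .
qed

end

section \<open>The two cases\<close>

lemma capelli_pair_capelli: "capelli_pair n (capelli_Z n) (capelli_D n) False"
  by unfold_locales
    (simp_all add: capelli_Z_def capelli_D_def z_op_comm dz_op_comm dz_op_z_op)

text \<open>
  The factor \<open>2\<close> on the diagonal of \<open>D\<close> is written as a second summand, which accounts for both deltas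
  in the commutator when \<open>j = k\<close>.
\<close>

lemma capelli_pair_turnbull: "capelli_pair n (turnbull_Z n) (turnbull_D n) True"
proof unfold_locales
  let ?dz = "\<lambda>a b. dz_op (min a b) (max a b)" and ?z = "\<lambda>a b. z_op (min a b) (max a b)"
  have D: "turnbull_D n $$ (a, b) = ?dz a b + (if a = b then ?dz a b else 0)" if "a < n" "b < n" for a b
    using that by (simp add: turnbull_D_def mult_2)
  have Z: "turnbull_Z n $$ (a, b) = ?z a b" if "a < n" "b < n" for a b
    using that by (simp add: turnbull_Z_def)
  fix i k j l assume ij: "i < n" "k < n" "j < n" "l < n"
  have comm_0: "comm x 0" "comm 0 x" for x :: "var diffop"
    by (simp_all add: comm_def)
  show "comm (turnbull_Z n $$ (i, k)) (turnbull_Z n $$ (j, l))"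
    "comm (turnbull_Z n $$ (i, k)) (cnj_op (turnbull_Z n $$ (j, l)))"
    using ij by (simp_all add: Z z_op_comm)
  show "comm (turnbull_D n $$ (i, k)) (turnbull_D n $$ (j, l))"
    using ij by (auto simp: D dz_op_comm comm_0 intro!: comm_add_left comm_add_right)
  show "comm (turnbull_D n $$ (i, k)) (cnj_op (turnbull_D n $$ (j, l)))"
    using ij by (auto simp: D dz_op_comm comm_0 cnj_op_add cnj_op_0 intro!: comm_add_left comm_add_right)
  show "comm (turnbull_D n $$ (j, k)) (cnj_op (turnbull_Z n $$ (i, l)))"
    using ij by (auto simp: D Z dz_op_z_op comm_0 intro!: comm_add_left)
  have b: "min j k = min i l \<and> max j k = max i l \<longleftrightarrow> (j = i \<and> k = l) \<or> (j = l \<and> k = i)"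
    by (auto simp: min_def max_def)
  show "turnbull_D n $$ (j, k) * turnbull_Z n $$ (i, l) = turnbull_Z n $$ (i, l) * turnbull_D n $$ (j, k)
      + of_bool (j = i \<and> k = l) + of_bool (True \<and> j = l \<and> k = i)"
    using ij by (auto simp: D Z distrib_left distrib_right dz_op_z_op(1) b)
  show "turnbull_Z n $$ (i, k) = turnbull_Z n $$ (k, i)"
    using ij by (simp add: Z min.commute max.commute)
qed (simp_all add: turnbull_Z_def turnbull_D_def)

theorem theorem7:
  fixes n r :: nat and I J :: "nat list" and Z D :: "var diffop mat" and s :: complex
  assumes "(Z = capelli_Z n \<and> D = capelli_D n) \<or> (Z = turnbull_Z n \<and> D = turnbull_D n)"
    and "length I = r" and "set I \<subseteq> {0..<n}"
    and "length J = r" and "set J \<subseteq> {0..<n}"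
    and "s = \<i> \<or> s = - \<i>"
  shows "col_det (real_form (minor_mat (Z * transpose_mat D) I J) + real_form (Q_mat I J) * T_mat s r)
    = (\<Sum>L\<in>increasing_indices (2 * r) (2 * n).
         col_det (minor_mat (real_form Z) (real_index I) L)
         * col_det (minor_mat (real_form (transpose_mat D)) L (real_index J)))"
proof -
  obtain symmetric where "capelli_pair n Z D symmetric"
    using assms(1) capelli_pair_capelli capelli_pair_turnbull by blast
  then interpret capelli_minor n Z D symmetric I J r
    using assms(2-5) by (simp add: capelli_minor_def capelli_minor_axioms_def)
  show ?thesis
    using assms(6) capelli_identity capelli_identity_conjugate by auto
qed

end
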